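(* Let $T_i x = A_i x + d_i$ ($1\le i\le m$) be affine maps of $\mathbb R^2$, where the $A_i$ are invertible $2\times 2$ real matrices with all entries strictly positive and $\|A_i\|_2<1$, and $d_i\in\mathbb R^2$. Let $E$ be the attractor (self-affine set) of the IFS $\{T_1,\dots,T_m\}$ and assume the strong separation condition, i.e. the sets $T_1(E),\dots,T_m(E)$ are pairwise disjoint. Let $\mu_F$ be the Furstenberg measure. Suppose that the projection of $E$ in direction $\theta$ has positive (one-dimensional) Lebesgue measure for a set of directions $\theta\in\mathbb{RP}^1$ of positive $\mu_F$-measure. Then $$\dim_B E=\dim_A E .$$
   Context: The attractor $E$ is the unique non-empty compact set with $E=\bigcup_{i=1}^m T_i(E)$. For words, $A_{a_1\cdots a_n}=A_{a_1}\cdots A_{a_n}$. For a matrix $A$ with singular values $\alpha_1\ge\alpha_2>0$ put $\phi^s(A)=\alpha_1^s$ for $0<s\le 1$ and $\phi^s(A)=\alpha_1\alpha_2^{s-1}$ for $s\ge 1$. The affinity dimension is $\dim_A E=\dim_A(A_1,\dots,A_m)=\inf\{s>0:\sum_{n\ge1}\sum_{a_1\cdots a_n\in\{1,\dots,m\}^n}\phi^s(A_{a_1\cdots a_n})<\infty\}$. $\Sigma=\{1,\dots,m\}^{\mathbb N}$ with left shift $\sigma$; $[a_1\cdots a_n]\subset\Sigma$ denotes a cylinder. The Käenmäki measure $\mu$ is the unique $\sigma$-invariant probability measure on $\Sigma$ (it is ergodic) for which, with $s=\dim_A(A_1,\dots,A_m)$, there is $C>0$ with $C^{-1}\phi^s(A_{a_1\cdots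 a_n})\le\mu[a_1\cdots a_n]\le C\phi^s(A_{a_1\cdots a_n})$ for all words. $\mathbb{RP}^1$ is the set of directions (unit vectors up to sign) in $\mathbb R^2$; $\mathcal Q_2\subset\mathbb{RP}^1$ is the set of directions of non-zero vectors $(x,y)$ with $xy\le0$. Let $\phi_i:\mathbb{RP}^1\to\mathbb{RP}^1$, $\phi_i(\theta)=A_i^{-1}\theta/\|A_i^{-1}\theta\|$; $\phi_i$ maps $\mathcal Q_2$ into itself. Let $\overline\mu$ be the unique shift-invariant measure on $\Sigma^{\pm}=\{1,\dots,m\}^{\mathbb Z}$ that agrees with $\mu$ on cylinders depending only on positive coordinates, and let $\rho(\overline a)=\lim_{n\to\infty}\phi_{a_0}\phi_{a_{-1}}\cdots\phi_{a_{-n}}(\theta)$, which exists and is independent of $\theta\in\mathcal Q_2$. The Furstenberg measure is $\mu_F=\overline\mu\circ\rho^{-1}$ (the stationary measure on $\mathbb{RP}^1$ for the maps $\phi_i$ chosen according to $\mu$). The projection of $E$ in direction $\theta$ is its image under orthogonal projection onto the line $\theta^\perp$. $\dim_B$ denotes box-counting dimension (the statement includes its existence). *)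

theory Defs
  imports "HOL-Probability.Probability"
begin

section \<open>Affine iterated function systems\<close>

text \<open>
  The index set \<open>{1, \<dots>, m}\<close> is a finite type \<open>'i\<close>, with \<open>m = CARD('i)\<close>; words are lists over \<open>'i\<close>.
\<close>

definition affine_map :: "('i \<Rightarrow> real^2^2) \<Rightarrow> ('i \<Rightarrow> real^2) \<Rightarrow> 'i \<Rightarrow> real^2 \<Rightarrow> real^2" where
  "affine_map A d i x = A i *v x + d i"

definition is_attractor :: "('i \<Rightarrow> 'a::topological_space \<Rightarrow> 'a) \<Rightarrow> 'a set \<Rightarrow> bool" where
  "is_attractor T E \<longleftrightarrow> compact E \<and> E \<noteq> {} \<and> E = (\<Union>i. T i ` E)"

definition strong_separation :: "('i \<Rightarrow> 'a \<Rightarrow> 'a) \<Rightarrow> 'a set \<Rightarrow> bool" where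
  "strong_separation T E \<longleftrightarrow> disjoint_family (\<lambda>i. T i ` E)"

definition word_matrix :: "('i \<Rightarrow> real^2^2) \<Rightarrow> 'i list \<Rightarrow> real^2^2" where
  "word_matrix A w = foldr (\<lambda>i M. A i ** M) w (mat 1)"


section \<open>Affinity dimension\<close>

text \<open>
  The square roots of the eigenvalues of the Gram matrix \<open>M\<^sup>T M\<close>. A \<open>2 \<times> 2\<close> matrix has two singular
  values counted with multiplicity, so they are the maximum and the minimum of this set.
\<close>

definition singular_values :: "real^2^2 \<Rightarrow> real set" where
  "singular_values M = {sqrt l | l. \<exists>v. v \<noteq> 0 \<and> (transpose M ** M) *v v = l *\<^sub>R v}"

definition sing_val1 :: "real^2^2 \<Rightarrow> real" where
  "sing_val1 M = Max (singular_values M)"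

definition sing_val2 :: "real^2^2 \<Rightarrow> real" where
  "sing_val2 M = Min (singular_values M)"

definition sv_fun :: "real \<Rightarrow> real^2^2 \<Rightarrow> real" where
  "sv_fun s M =
     (if s \<le> 1 then sing_val1 M powr s else sing_val1 M * sing_val2 M powr (s - 1))"

definition affinity_dim :: "('i::finite \<Rightarrow> real^2^2) \<Rightarrow> real" where
  "affinity_dim A =
     Inf {s. s > 0 \<and> summable (\<lambda>n. \<Sum>w | length w = Suc n. sv_fun s (word_matrix A w))}"


section \<open>The Kaenmaki measure\<close>

text \<open>
  The sequence \<open>a\<^sub>1 a\<^sub>2 \<dots>\<close> is the function \<open>x\<close> with \<open>x n = a\<^sub>n\<^sub>+\<^sub>1\<close>.
\<close>

definition one_sided :: "(nat \<Rightarrow> 'i) measure" where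
  "one_sided = PiM UNIV (\<lambda>_. count_space UNIV)"

definition cylinder :: "'i list \<Rightarrow> (nat \<Rightarrow> 'i) set" where
  "cylinder w = {x. \<forall>k < length w. x k = w ! k}"

definition is_kaenmaki_measure ::
    "('i::finite \<Rightarrow> real^2^2) \<Rightarrow> (nat \<Rightarrow> 'i) measure \<Rightarrow> bool" where
  "is_kaenmaki_measure A \<mu> \<longleftrightarrow>
     sets \<mu> = sets one_sided \<and> prob_space \<mu> \<and>
     distr \<mu> \<mu> (\<lambda>x n. x (Suc n)) = \<mu> \<and>
     (\<exists>C>0. \<forall>w. inverse C * sv_fun (affinity_dim A) (word_matrix A w) \<le> measure \<mu> (cylinder w) \<and>
                measure \<mu> (cylinder w) \<le> C * sv_fun (affinity_dim A) (word_matrix A w))"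


section \<open>The projective line\<close>

quotient_type rp1 = "real^2" / partial: "\<lambda>x y. norm x = 1 \<and> norm y = 1 \<and> (x = y \<or> x = - y)"
proof (rule part_equivpI)
  show "\<exists>x :: real^2. norm x = 1 \<and> norm x = 1 \<and> (x = x \<or> x = - x)"
    using vector_choose_size[of 1] by auto
qed (auto simp: symp_def transp_def)

definition direction :: "real^2 \<Rightarrow> rp1" where
  "direction v = abs_rp1 (v /\<^sub>R norm v)"

lemma norm_rep_rp1 [simp]: "norm (rep_rp1 \<theta>) = 1"
  using Quotient3_rep_reflp[OF Quotient3_rp1, of \<theta>] by simp

lemma abs_rep_rp1 [simp]: "abs_rp1 (rep_rp1 \<theta>) = \<theta>"
  by (rule Quotient3_abs_rep[OF Quotient3_rp1])

lemma abs_rp1_eq_iff: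
  "norm x = 1 \<Longrightarrow> norm y = 1 \<Longrightarrow> abs_rp1 x = abs_rp1 y \<longleftrightarrow> x = y \<or> x = - y"
  using Quotient3_rel[OF Quotient3_rp1, of x y] by auto

lemma rep_abs_rp1: "norm x = 1 \<Longrightarrow> rep_rp1 (abs_rp1 x) = x \<or> rep_rp1 (abs_rp1 x) = - x"
  using abs_rp1_eq_iff[of "rep_rp1 (abs_rp1 x)" x] by auto

lemma direction_rep [simp]: "direction (rep_rp1 \<theta>) = \<theta>"
  by (simp add: direction_def)

lemma direction_uminus: "v \<noteq> 0 \<Longrightarrow> direction (- v) = direction v"
  by (simp add: direction_def abs_rp1_eq_iff)

text \<open>
  The chordal metric; it induces the quotient topology, and the Borel sets of \<open>rp1\<close> refer to it.
\<close>

instantiation rp1 :: metric_space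
begin

definition dist_rp1 :: "rp1 \<Rightarrow> rp1 \<Rightarrow> real" where
  "dist_rp1 p q = min (norm (rep_rp1 p - rep_rp1 q)) (norm (rep_rp1 p + rep_rp1 q))"

definition uniformity_rp1 :: "(rp1 \<times> rp1) filter" where
  "uniformity_rp1 = (INF e\<in>{0 <..}. principal {(x, y). dist x y < e})"

definition open_rp1 :: "rp1 set \<Rightarrow> bool" where
  "open_rp1 U = (\<forall>x\<in>U. \<forall>\<^sub>F (x', y) in uniformity. x' = x \<longrightarrow> y \<in> U)"

instance
proof
  fix x y z :: rp1
  show "dist x y = 0 \<longleftrightarrow> x = y"
  proof
    assume "dist x y = 0"
    then have "rep_rp1 x = rep_rp1 y \<or> rep_rp1 x = - rep_rp1 y"
      by (auto simp: dist_rp1_def min_def add_eq_0_iff2 split: if_splits)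
    then show "x = y"
      by (metis abs_rp1_eq_iff abs_rep_rp1 norm_rep_rp1)
  qed (simp add: dist_rp1_def)
  have tri: "norm (a - b) \<le> norm (a - c) + norm (b - c)"
            "norm (a - b) \<le> norm (a + c) + norm (b + c)"
            "norm (a + b) \<le> norm (a - c) + norm (b + c)"
            "norm (a + b) \<le> norm (a + c) + norm (b - c)" for a b c :: "real^2"
    using norm_triangle_ineq4[of "a - c" "b - c"] norm_triangle_ineq4[of "a + c" "b + c"]
      norm_triangle_ineq[of "a - c" "b + c"] norm_triangle_ineq[of "a + c" "b - c"]
    by simp_all
  show "dist x y \<le> dist x z + dist y z"
    unfolding dist_rp1_def using tri[of "rep_rp1 x" "rep_rp1 y" "rep_rp1 z"] by linarith
qed (rule uniformity_rp1_def open_rp1_def)+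

end


section \<open>The Furstenberg measure\<close>

definition Q2 :: "rp1 set" where
  "Q2 = {direction v | v. v \<noteq> 0 \<and> v $ 1 * v $ 2 \<le> 0}"

definition inv_action :: "real^2^2 \<Rightarrow> rp1 \<Rightarrow> rp1" where
  "inv_action M \<theta> = direction (matrix_inv M *v rep_rp1 \<theta>)"

text \<open>
  Independence of the chosen representative: for invertible \<open>M\<close>, this is the map induced on
  directions by the inverse of \<open>M\<close>.
\<close>

lemma inv_action_direction:
  assumes "invertible M" "norm v = 1"
  shows "inv_action M (direction v) = direction (matrix_inv M *v v)"
proof -
  have "v \<noteq> 0"
    using assms(2) by auto
  moreover have "M ** matrix_inv M = mat 1"
    using assms(1) unfolding invertible_def matrix_inv_def by (rule someI2_ex) simp
  ultimately have "matrix_inv M *v v \<noteq> 0"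
    by (metis matrix_vector_mul_assoc matrix_vector_mul_lid
        matrix_vector_mult_0_right)
  moreover have "rep_rp1 (direction v) = v \<or> rep_rp1 (direction v) = - v"
    using rep_abs_rp1[OF assms(2)] assms(2) by (simp add: direction_def)
  moreover have "matrix_inv M *v (- v) = - (matrix_inv M *v v)"
    using matrix_vector_mult_diff_distrib[of "matrix_inv M" 0 v] by simp
  ultimately show ?thesis
    by (auto simp: inv_action_def direction_uminus)
qed

definition two_sided :: "(int \<Rightarrow> 'i) measure" where
  "two_sided = PiM UNIV (\<lambda>_. count_space UNIV)"

text \<open>The positive coordinates are \<open>1, 2, \<dots>\<close>.\<close>

definition positive_cylinder :: "'i list \<Rightarrow> (int \<Rightarrow> 'i) set" where
  "positive_cylinder w = {a. \<forall>k < length w. a (int k + 1) = w ! k}"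

definition is_natural_extension ::
    "(nat \<Rightarrow> 'i) measure \<Rightarrow> (int \<Rightarrow> 'i) measure \<Rightarrow> bool" where
  "is_natural_extension \<mu> \<nu> \<longleftrightarrow>
     sets \<nu> = sets two_sided \<and>
     distr \<nu> \<nu> (\<lambda>a k. a (k + 1)) = \<nu> \<and>
     (\<forall>w. emeasure \<nu> (positive_cylinder w) = emeasure \<mu> (cylinder w))"

definition backward_iterate :: "('i \<Rightarrow> real^2^2) \<Rightarrow> (int \<Rightarrow> 'i) \<Rightarrow> nat \<Rightarrow> rp1 \<Rightarrow> rp1" where
  "backward_iterate A a n \<theta> = foldr (\<lambda>k. inv_action (A (a (- int k)))) [0..<Suc n] \<theta>"

definition furstenberg_map :: "('i \<Rightarrow> real^2^2) \<Rightarrow> (int \<Rightarrow> 'i) \<Rightarrow> rp1" where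
  "furstenberg_map A a = (THE l. \<forall>\<theta>\<in>Q2. (\<lambda>n. backward_iterate A a n \<theta>) \<longlonglongrightarrow> l)"

definition furstenberg_measure ::
    "('i \<Rightarrow> real^2^2) \<Rightarrow> (int \<Rightarrow> 'i) measure \<Rightarrow> rp1 measure" where
  "furstenberg_measure A \<nu> = distr \<nu> borel (furstenberg_map A)"


section \<open>Projections and box-counting dimension\<close>

definition projection_along :: "rp1 \<Rightarrow> real^2 \<Rightarrow> real^2" where
  "projection_along \<theta> x = x - (x \<bullet> rep_rp1 \<theta>) *\<^sub>R rep_rp1 \<theta>"

text \<open>
  One-dimensional Lebesgue measure on the line orthogonal to \<open>\<theta>\<close>, transported from the real line
  along the isometry that sends \<open>t\<close> to \<open>t\<close> times a unit normal vector of \<open>\<theta>\<close>.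
\<close>

definition lebesgue_perp :: "rp1 \<Rightarrow> (real^2) measure" where
  "lebesgue_perp \<theta> =
     distr lborel borel (\<lambda>t. t *\<^sub>R vector [- (rep_rp1 \<theta> $ 2), rep_rp1 \<theta> $ 1])"

text \<open>
  The conjunct \<open>bounded U\<close> is needed because \<open>diameter\<close> is an arbitrary value on unbounded sets.
\<close>

definition covering_number :: "'a::metric_space set \<Rightarrow> real \<Rightarrow> nat" where
  "covering_number E \<delta> =
     (LEAST n. \<exists>F. finite F \<and> card F = n \<and> E \<subseteq> \<Union>F \<and> (\<forall>U\<in>F. bounded U \<and> diameter U \<le> \<delta>))"

text \<open>The box-counting dimension exists and equals \<open>s\<close>.\<close>

definition has_box_dim :: "'a::metric_space set \<Rightarrow> real \<Rightarrow> bool" where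
  "has_box_dim E s \<longleftrightarrow>
     ((\<lambda>\<delta>. ln (real (covering_number E \<delta>)) / - ln \<delta>) \<longlongrightarrow> s) (at_right 0)"

end

theory Submission
  imports Defs "HOL-Library.Sublist" "HOL-Real_Asymp.Real_Asymp"
begin

text \<open>
  Fix a scale \<open>\<delta>\<close>. Cutting the past \<open>\<dots> a\<^sub>-\<^sub>1 a\<^sub>0\<close> of a two-sided sequence where the smaller singular
  value drops below \<open>\<delta>\<close> gives words \<open>w\<close> ending at coordinate \<open>0\<close>; by shift invariance their cylinders
  carry total mass \<open>1\<close>. The Furstenberg direction \<open>\<rho>(a)\<close> is mapped by \<open>A\<^sub>w\<close> into the second quadrant for
  every such \<open>w\<close>, so the projection of \<open>T\<^sub>w(E)\<close> along this image is the projection of \<open>E\<close> along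
  \<open>\<rho>(a)\<close>, stretched by a factor comparable to \<open>\<alpha>\<^sub>1(A\<^sub>w)\<close>. Hence a set of words of \<open>\<mu>\<close>-mass bounded
  below satisfies that \<open>T\<^sub>w(E)\<close> needs at least \<open>c \<alpha>\<^sub>1(A\<^sub>w) / \<delta>\<close> sets of diameter \<open>\<delta>\<close>, and
  \<open>\<alpha>\<^sub>1(A\<^sub>w) / \<delta>\<close> is comparable to \<open>\<delta>\<^sup>-\<^sup>s \<phi>\<^sup>s(A\<^sub>w)\<close>. Two of these words that are not prefixes of each other
  have images at distance at least a multiple of \<open>\<delta>\<close>, and a chain of prefixes among them has bounded
  length, so a covering set is counted boundedly often and the covering number is at least
  \<open>c \<delta>\<^sup>-\<^sup>s\<close>. The upper bound \<open>C \<delta>\<^sup>-\<^sup>s\<close> comes from cutting words off on the right, which makes them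
  prefix-free.
\<close>

section \<open>Singular values of planar matrices\<close>

lemma norm_eq_2: "norm (x :: real^2) ^ 2 = (x $ 1)\<^sup>2 + (x $ 2)\<^sup>2"
  by (simp add: norm_vec_def L2_set_def sum_2)

text \<open>\<open>p\<close>, \<open>q\<close>, \<open>r\<close> are the entries of the symmetric
  Gram matrix, and the condition on \<open>l\<close> is its characteristic equation.\<close>

lemma singular_values_gram:
  fixes M :: "real^2^2"
  defines "p \<equiv> (M$1$1)\<^sup>2 + (M$2$1)\<^sup>2" and "q \<equiv> M$1$1 * M$1$2 + M$2$1 * M$2$2"
    and "r \<equiv> (M$1$2)\<^sup>2 + (M$2$2)\<^sup>2"
  shows "singular_values M = {sqrt l | l. (l - p) * (l - r) = q\<^sup>2}"
proof -
  have eq: "(\<exists>v. v \<noteq> 0 \<and> (transpose M ** M) *v v = l *\<^sub>R v) \<longleftrightarrow> (l - p) * (l - r) = q\<^sup>2" for l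
  proof -
    have 1: "(transpose M ** M) *v v = l *\<^sub>R v \<longleftrightarrow>
       q * v$2 = (l - p) * v$1 \<and> q * v$1 = (l - r) * v$2" for v
      by (simp add: vec_eq_iff forall_2 matrix_vector_mult_def matrix_matrix_mult_def transpose_def
          sum_2 p_def q_def r_def algebra_simps power2_eq_square)
    show ?thesis
    proof
      assume "\<exists>v. v \<noteq> 0 \<and> (transpose M ** M) *v v = l *\<^sub>R v"
      then obtain v where v0: "v \<noteq> 0" and "(transpose M ** M) *v v = l *\<^sub>R v"
        by auto
      then have v: "q * v$2 = (l - p) * v$1" "q * v$1 = (l - r) * v$2"
        by (simp_all only: 1)
      have "(l - p) * (l - r) * v$1 = (l - r) * ((l - p) * v$1)" by (simp only: ac_simps)
      also have "\<dots> = q * ((l - r) * v$2)" unfolding v(1)[symmetric] by (simp only: ac_simps)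
      finally have 2: "(l - p) * (l - r) * v$1 = q\<^sup>2 * v$1"
        unfolding v(2)[symmetric] by (simp only: power2_eq_square ac_simps)
      have "(l - p) * (l - r) * v$2 = (l - p) * ((l - r) * v$2)" by (simp only: ac_simps)
      also have "\<dots> = q * ((l - p) * v$1)" unfolding v(2)[symmetric] by (simp only: ac_simps)
      finally have 3: "(l - p) * (l - r) * v$2 = q\<^sup>2 * v$2"
        unfolding v(1)[symmetric] by (simp only: power2_eq_square ac_simps)
      have "v $ 1 \<noteq> 0 \<or> v $ 2 \<noteq> 0"
        using v0 by (auto simp: vec_eq_iff forall_2)
      with 2 3 show "(l - p) * (l - r) = q\<^sup>2"
        by (metis mult_cancel_right)
    next
      assume l: "(l - p) * (l - r) = q\<^sup>2"
      show "\<exists>v. v \<noteq> 0 \<and> (transpose M ** M) *v v = l *\<^sub>R v"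
      \<comment> \<open>The eigenvector \<open>(q, l - p)\<close> is read off from the first of the
        two equations. It degenerates to zero exactly in this case, where the first axis is an
        eigenvector instead.\<close>
      proof (cases "q = 0 \<and> l = p")
        case True
        then show ?thesis
          by (intro exI[of _ "vector [1, 0]"] conjI, simp add: vec_eq_iff forall_2)
            (unfold 1, simp)
      next
        case False
        then show ?thesis using l
          by (intro exI[of _ "vector [q, l - p]"] conjI, simp add: vec_eq_iff forall_2)
            (unfold 1, simp add: power2_eq_square mult.commute)
      qed
    qed
  qed
  show ?thesis unfolding singular_values_def eq ..
qed

text \<open>For an eigenvector \<open>v\<close> of the Gram matrix, the squared norm of
  \<open>M *v v\<close> is the inner product of \<open>v\<close> with its Gram image, hence the
  eigenvalue times the squared norm of \<open>v\<close>.\<close>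

lemma singular_values_norm:
  assumes "l \<in> singular_values M"
  obtains v where "v \<noteq> 0" "norm (M *v v) = l * norm v"
proof -
  from assms obtain k v where k: "l = sqrt k" and v: "v \<noteq> 0" "(transpose M ** M) *v v = k *\<^sub>R v"
    by (auto simp: singular_values_def)
  have "(norm (M *v v))\<^sup>2 = v \<bullet> ((transpose M ** M) *v v)"
    unfolding power2_norm_eq_inner dot_lmul_matrix[symmetric] matrix_vector_mul_assoc[symmetric]
    by (metis dot_lmul_matrix inner_commute transpose_matrix_vector)
  also have "\<dots> = k * (norm v)\<^sup>2"
    by (simp add: v power2_norm_eq_inner)
  finally have "norm (M *v v) = sqrt (k * (norm v)\<^sup>2)"
    by (metis norm_ge_zero real_sqrt_unique)
  then show ?thesis
    using that v k by (simp add: real_sqrt_mult)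
qed

text \<open>The discriminant vanishes, so the mixed term is in absolute value twice the product of
  the roots of the two square terms, and the inequality between arithmetic and geometric mean
  applies.\<close>

lemma nonneg_quadratic_form:
  fixes u w q x y :: real
  assumes "u \<ge> 0" "w \<ge> 0" "u * w = q\<^sup>2"
  shows "u * x\<^sup>2 - 2 * q * x * y + w * y\<^sup>2 \<ge> 0"
proof -
  have "\<bar>q\<bar> = sqrt u * sqrt w"
    using assms by (metis real_sqrt_abs real_sqrt_mult)
  then have "\<bar>2 * q * x * y\<bar> = 2 * (sqrt u * \<bar>x\<bar>) * (sqrt w * \<bar>y\<bar>)"
    by (simp add: abs_mult)
  also have "\<dots> \<le> (sqrt u * \<bar>x\<bar>)\<^sup>2 + (sqrt w * \<bar>y\<bar>)\<^sup>2"
    by (rule sum_squares_bound)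
  also have "\<dots> = u * x\<^sup>2 + w * y\<^sup>2"
    using assms by (simp add: power_mult_distrib)
  finally show ?thesis by linarith
qed

text \<open>With \<open>l2 \<le> l1\<close> the eigenvalues of the Gram matrix, both
  \<open>l1\<close> minus the Gram form and the Gram form minus \<open>l2\<close> are degenerate
  nonnegative forms. The product of the eigenvalues is the squared determinant.\<close>

lemma sing_val_properties:
  fixes M :: "real^2^2"
  shows sing_val1_norm_le: "norm (M *v x) \<le> sing_val1 M * norm x"
    and sing_val2_norm_ge: "sing_val2 M * norm x \<le> norm (M *v x)"
    and sing_val1_mem: "sing_val1 M \<in> singular_values M"
    and sing_val2_mem: "sing_val2 M \<in> singular_values M"
    and sing_val_mult: "sing_val1 M * sing_val2 M = \<bar>det M\<bar>"
proof -
  define p q r where "p = (M$1$1)\<^sup>2 + (M$2$1)\<^sup>2" and "q = M$1$1 * M$1$2 + M$2$1 * M$2$2"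
    and "r = (M$1$2)\<^sup>2 + (M$2$2)\<^sup>2"
  \<comment> \<open>The root of the discriminant of the characteristic polynomial. That it dominates
    \<open>\<bar>p - r\<bar>\<close> makes \<open>l1 - p\<close>, \<open>l1 - r\<close>,
    \<open>p - l2\<close> and \<open>r - l2\<close> nonnegative.\<close>
  define t where "t = sqrt ((p - r)\<^sup>2 + 4 * q\<^sup>2)"
  have t2: "t * t = (p - r) * (p - r) + 4 * (q * q)"
    unfolding t_def by (simp add: power2_eq_square[symmetric])
  have t: "t \<ge> \<bar>p - r\<bar>"
    unfolding t_def by (rule real_le_rsqrt) simp
  define l1 l2 where "l1 = (p + r + t) / 2" and "l2 = (p + r - t) / 2"
  have roots: "(l - p) * (l - r) = q\<^sup>2 \<longleftrightarrow> l = l1 \<or> l = l2" for l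
  proof -
    have "(l - p) * (l - r) - q\<^sup>2 = (l - l1) * (l - l2)"
      using t2 by (simp add: l1_def l2_def power2_eq_square field_simps)
    then show ?thesis by auto
  qed
  have sv: "singular_values M = {sqrt l1, sqrt l2}"
    unfolding singular_values_gram p_def[symmetric] q_def[symmetric] r_def[symmetric] roots by auto
  have "l2 \<le> l1" using t by (simp add: l1_def l2_def)
  then have s: "sing_val1 M = sqrt l1" "sing_val2 M = sqrt l2"
    unfolding sing_val1_def sing_val2_def sv by (simp_all add: max_def min_def)
  show "sing_val1 M \<in> singular_values M" "sing_val2 M \<in> singular_values M"
    by (simp_all add: s sv)
  have Mx: "(norm (M *v x))\<^sup>2 = p * (x$1)\<^sup>2 + 2 * q * x$1 * x$2 + r * (x$2)\<^sup>2" for x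
    unfolding norm_eq_2
    by (simp add: matrix_vector_mult_def sum_2 p_def q_def r_def power2_eq_square algebra_simps)
  have prod: "l1 * l2 = (det M)\<^sup>2"
  proof -
    have "l1 * l2 = p * r - q * q"
      using t2 by (simp add: l1_def l2_def field_simps)
    then show ?thesis
      by (simp add: p_def q_def r_def det_2 power2_eq_square algebra_simps)
  qed
  then show "sing_val1 M * sing_val2 M = \<bar>det M\<bar>"
    by (simp add: s real_sqrt_mult[symmetric])
  have up: "(norm (M *v x))\<^sup>2 \<le> l1 * (norm x)\<^sup>2" for x
  proof -
    have "(l1 - p) * (x$1)\<^sup>2 - 2 * q * x$1 * x$2 + (l1 - r) * (x$2)\<^sup>2 \<ge> 0"
      using t roots[of l1] by (intro nonneg_quadratic_form) (auto simp: l1_def)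
    then show ?thesis unfolding Mx norm_eq_2[of x] by (simp add: algebra_simps)
  qed
  have lo: "(norm (M *v x))\<^sup>2 \<ge> l2 * (norm x)\<^sup>2" for x
  proof -
    have "(p - l2) * (x$1)\<^sup>2 - 2 * (- q) * x$1 * x$2 + (r - l2) * (x$2)\<^sup>2 \<ge> 0"
      using t roots[of l2] by (intro nonneg_quadratic_form) (auto simp: l2_def algebra_simps)
    then show ?thesis unfolding Mx norm_eq_2[of x] by (simp add: algebra_simps)
  qed
  show "norm (M *v x) \<le> sing_val1 M * norm x"
    using real_sqrt_le_mono[OF up[of x]] by (simp add: s real_sqrt_mult)
  show "sing_val2 M * norm x \<le> norm (M *v x)"
    using real_sqrt_le_mono[OF lo[of x]] by (simp add: s real_sqrt_mult)
qed

lemma sing_val1_attained: obtains v where "v \<noteq> 0" "norm (M *v v) = sing_val1 M * norm v"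
  using singular_values_norm[OF sing_val1_mem[of M]] .

lemma sing_val2_attained: obtains v where "v \<noteq> 0" "norm (M *v v) = sing_val2 M * norm v"
  using singular_values_norm[OF sing_val2_mem[of M]] .

section \<open>Singular values of products and of nonnegative matrices\<close>

lemma sing_val1_nonneg: "sing_val1 M \<ge> 0"
  by (metis sing_val1_attained norm_ge_zero zero_le_mult_iff zero_less_norm_iff linorder_not_less)

lemma sing_val2_nonneg: "sing_val2 M \<ge> 0"
  by (metis sing_val2_attained norm_ge_zero zero_le_mult_iff zero_less_norm_iff linorder_not_less)

lemma sing_val_pos:
  assumes "invertible M"
  shows "sing_val1 M > 0" "sing_val2 M > 0"
  using assms sing_val_mult[of M] sing_val1_nonneg[of M] sing_val2_nonneg[of M]
  by (auto simp: invertible_det_nz less_le)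

lemma sing_val2_le_sing_val1: "sing_val2 M \<le> sing_val1 M"
  using sing_val1_norm_le[of M "axis 1 1"] sing_val2_norm_ge[of M "axis 1 1"] by simp

lemma sing_val1_le:
  assumes "\<And>x. norm (M *v x) \<le> c * norm x"
  shows "sing_val1 M \<le> c"
  by (metis assms sing_val1_attained mult_le_cancel_right_pos zero_less_norm_iff)

lemma sing_val1_mult_le: "sing_val1 (M ** N) \<le> sing_val1 M * sing_val1 N"
proof (rule sing_val1_le)
  fix x
  have "norm ((M ** N) *v x) \<le> sing_val1 M * norm (N *v x)"
    using sing_val1_norm_le[of M "N *v x"] by (simp add: matrix_vector_mul_assoc)
  also have "\<dots> \<le> sing_val1 M * (sing_val1 N * norm x)"
    by (intro mult_left_mono sing_val1_norm_le sing_val1_nonneg)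
  finally show "norm ((M ** N) *v x) \<le> sing_val1 M * sing_val1 N * norm x" by simp
qed

lemma sing_val2_mult_ge: "sing_val2 M * sing_val2 N \<le> sing_val2 (M ** N)"
proof -
  obtain v where v: "v \<noteq> 0" "norm ((M ** N) *v v) = sing_val2 (M ** N) * norm v"
    by (rule sing_val2_attained)
  have "sing_val2 M * (sing_val2 N * norm v) \<le> sing_val2 M * norm (N *v v)"
    by (intro mult_left_mono sing_val2_norm_ge sing_val2_nonneg)
  also have "\<dots> \<le> norm ((M ** N) *v v)"
    using sing_val2_norm_ge[of M "N *v v"] by (simp add: matrix_vector_mul_assoc)
  finally show ?thesis using v by (simp add: mult.assoc[symmetric])
qed

text \<open>A vector on which \<open>M\<close> attains its least stretch is pulled back through
  \<open>N\<close>, which cannot have shortened its preimage by less than the factor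
  \<open>1 / sing_val1 N\<close>.\<close>

lemma sing_val2_mult_le:
  assumes "invertible N"
  shows "sing_val2 (M ** N) \<le> sing_val2 M * sing_val1 N"
proof -
  obtain v where v: "v \<noteq> 0" "norm (M *v v) = sing_val2 M * norm v"
    by (rule sing_val2_attained)
  obtain x where x: "N *v x = v"
    using assms by (metis invertible_right_inverse matrix_right_invertible_surjective surjE)
  have "sing_val2 (M ** N) * norm x \<le> norm (M *v v)"
    using sing_val2_norm_ge[of "M ** N" x] by (simp add: matrix_vector_mul_assoc[symmetric] x)
  also have "\<dots> \<le> sing_val2 M * (sing_val1 N * norm x)"
    using sing_val1_norm_le[of N x] v sing_val2_nonneg[of M] by (simp add: x mult_left_mono)
  finally have "sing_val2 (M ** N) * norm x \<le> (sing_val2 M * sing_val1 N) * norm x"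
    by simp
  moreover have "norm x > 0" using v x by auto
  ultimately show ?thesis by (simp only: mult_le_cancel_right_pos)
qed

lemma sing_val_mat_1: "sing_val1 (mat 1) = 1" "sing_val2 (mat 1) = 1"
proof -
  show "sing_val1 (mat 1) = 1"
    by (rule sing_val1_attained[of "mat 1"]) simp
  show "sing_val2 (mat 1) = 1"
    by (rule sing_val2_attained[of "mat 1"]) simp
qed

text \<open>Compares the Euclidean norm with the sum of absolute coordinates. It later makes row
  sums an upper bound for the larger singular value.\<close>

lemma sing_val1_le_entries:
  fixes M :: "real^2^2"
  assumes "\<And>i j. M $ i $ j \<ge> 0"
  shows "sing_val1 M \<le> M$1$1 + M$1$2 + M$2$1 + M$2$2"
proof (rule sing_val1_le)
  fix x :: "real^2"
  have c: "\<bar>x $ i\<bar> \<le> norm x" for i by (rule component_le_norm_cart)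
  have "norm (M *v x) \<le> \<bar>(M *v x) $ 1\<bar> + \<bar>(M *v x) $ 2\<bar>"
    using norm_le_l1_cart[of "M *v x"] by (simp add: sum_2)
  also have "\<dots> \<le> (M$1$1 * \<bar>x$1\<bar> + M$1$2 * \<bar>x$2\<bar>) + (M$2$1 * \<bar>x$1\<bar> + M$2$2 * \<bar>x$2\<bar>)"
    using assms by (auto simp: matrix_vector_mult_def sum_2 abs_mult intro!: add_mono order_trans[OF abs_triangle_ineq])
  also have "\<dots> \<le> (M$1$1 * norm x + M$1$2 * norm x) + (M$2$1 * norm x + M$2$2 * norm x)"
    using assms c by (intro add_mono mult_left_mono) auto
  finally show "norm (M *v x) \<le> (M$1$1 + M$1$2 + M$2$1 + M$2$2) * norm x"
    by (simp add: algebra_simps)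
qed

section \<open>The Furstenberg direction\<close>

lemma direction_scaleR:
  assumes "c \<noteq> 0" "v \<noteq> 0"
  shows "direction (c *\<^sub>R v) = direction v"
proof (cases "c > 0")
  case True
  then show ?thesis using assms by (simp add: direction_def field_simps)
next
  case False
  have "(c *\<^sub>R v) /\<^sub>R norm (c *\<^sub>R v) = - (v /\<^sub>R norm v)"
    using False assms by (simp add: field_simps)
  then show ?thesis using assms by (simp add: direction_def abs_rp1_eq_iff)
qed

lemma rep_direction:
  assumes "v \<noteq> 0"
  obtains c where "c \<noteq> 0" "rep_rp1 (direction v) = c *\<^sub>R v"
proof -
  have "rep_rp1 (direction v) = v /\<^sub>R norm v \<or> rep_rp1 (direction v) = - (v /\<^sub>R norm v)"
    unfolding direction_def using assms by (intro rep_abs_rp1) simp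
  then show ?thesis
    using that[of "1 / norm v"] that[of "- 1 / norm v"] assms
    by (auto simp: divide_inverse)
qed

lemma dist_direction_le:
  assumes "v \<noteq> 0" "w \<noteq> 0"
  shows "dist (direction v) (direction w) \<le> norm (v /\<^sub>R norm v - w /\<^sub>R norm w)"
proof -
  have "rep_rp1 (direction u) = u /\<^sub>R norm u \<or> rep_rp1 (direction u) = - (u /\<^sub>R norm u)"
    if "u \<noteq> 0" for u
    unfolding direction_def using that by (intro rep_abs_rp1) simp
  from this[OF assms(1)] this[OF assms(2)] show ?thesis
    by (auto simp: dist_rp1_def norm_minus_commute intro: min.coboundedI1 min.coboundedI2)
qed

lemma tendsto_direction:
  assumes "(f \<longlongrightarrow> v) F" "v \<noteq> 0" "\<And>x. f x \<noteq> 0"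
  shows "((\<lambda>x. direction (f x)) \<longlongrightarrow> direction v) F"
proof -
  have "((\<lambda>x. norm (f x /\<^sub>R norm (f x) - v /\<^sub>R norm v)) \<longlongrightarrow> norm (v /\<^sub>R norm v - v /\<^sub>R norm v)) F"
    using assms by (intro tendsto_intros) auto
  then have "((\<lambda>x. norm (f x /\<^sub>R norm (f x) - v /\<^sub>R norm v)) \<longlongrightarrow> 0) F"
    by simp
  then have "((\<lambda>x. dist (direction (f x)) (direction v)) \<longlongrightarrow> 0) F"
    by (rule Lim_null_comparison[rotated]) (use assms dist_direction_le in auto)
  then show ?thesis by (simp add: tendsto_dist_iff[symmetric])
qed

lemma tendsto_vec_iff_2:
  "(f \<longlongrightarrow> (v :: real^2)) F \<longleftrightarrow> ((\<lambda>x. f x $ 1) \<longlongrightarrow> v $ 1) F \<and> ((\<lambda>x. f x $ 2) \<longlongrightarrow> v $ 2) F"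
  using forall_2[of "\<lambda>i. ((\<lambda>x. f x $ i) \<longlongrightarrow> v $ i) F"]
  by (metis tendsto_vec_nth vec_tendstoI)

lemma invertible_mult_eq_0_iff:
  fixes M :: "real^'n^'n"
  assumes "invertible M"
  shows "M *v v = 0 \<longleftrightarrow> v = 0"
  using assms by (metis matrix_left_invertible_ker invertible_left_inverse matrix_vector_mult_0_right)

text \<open>Lets the backward iterates be computed by stripping matrices off a vector, without
  handling inverse matrices.\<close>

lemma inv_action_mult:
  assumes M: "invertible M" and v: "v \<noteq> 0"
  shows "inv_action M (direction (M *v v)) = direction v"
proof -
  obtain c where c: "c \<noteq> 0" "rep_rp1 (direction (M *v v)) = c *\<^sub>R (M *v v)"
    using rep_direction[of "M *v v"] invertible_mult_eq_0_iff[OF M] v by blast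
  have "matrix_inv M ** M = mat 1"
    using M unfolding invertible_def matrix_inv_def by (rule someI2_ex) simp
  then have "matrix_inv M *v (c *\<^sub>R (M *v v)) = c *\<^sub>R v"
    by (simp add: matrix_vector_mult_scaleR matrix_vector_mul_assoc)
  then show ?thesis
    using c v by (simp add: inv_action_def direction_scaleR)
qed

text \<open>The cone of vectors over \<open>Q2\<close>. Being symmetric under sign change it
  contains the closed fourth quadrant as well, without the origin.\<close>

definition second_quadrant :: "(real^2) set" where
  "second_quadrant = {v. v \<noteq> 0 \<and> v $ 1 * v $ 2 \<le> 0}"

lemma Q2_eq: "Q2 = direction ` second_quadrant"
  by (auto simp: Q2_def second_quadrant_def)

lemma scaleR_second_quadrant_iff:
  assumes "c \<noteq> 0"
  shows "c *\<^sub>R v \<in> second_quadrant \<longleftrightarrow> v \<in> second_quadrant"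
proof -
  have eq: "(c *\<^sub>R v) $ 1 * (c *\<^sub>R v) $ 2 = c\<^sup>2 * (v $ 1 * v $ 2)"
    by (simp add: power2_eq_square)
  have "(c *\<^sub>R v) $ 1 * (c *\<^sub>R v) $ 2 \<le> 0 \<longleftrightarrow> v $ 1 * v $ 2 \<le> 0"
    unfolding eq using mult_le_cancel_left_pos[of "c\<^sup>2" "v $ 1 * v $ 2" 0] assms by simp
  then show ?thesis using assms
    unfolding second_quadrant_def mem_Collect_eq scaleR_eq_0_iff by blast
qed

section \<open>Word matrices, pasts and row shares\<close>

lemma word_matrix_simps [simp]:
  "word_matrix A [] = mat 1"
  "word_matrix A (i # w) = A i ** word_matrix A w"
  by (simp_all add: word_matrix_def)

lemma word_matrix_append:
  "word_matrix A (u @ v) = word_matrix A u ** word_matrix A v"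
  by (induction u) (simp_all add: matrix_mul_assoc)

text \<open>The word of the coordinates \<open>1 - n\<close> up to \<open>0\<close>, oldest letter
  first. Looking one step further back therefore adds a letter on the left, and the backward iterate
  applies the inverse of the matrix of this word.\<close>

definition past :: "(int \<Rightarrow> 'i) \<Rightarrow> nat \<Rightarrow> 'i list" where
  "past a n = map (\<lambda>k. a (- int k)) (rev [0..<n])"

lemma past_0 [simp]: "past a 0 = []"
  and past_Suc [simp]: "past a (Suc n) = a (- int n) # past a n"
  and length_past [simp]: "length (past a n) = n"
  by (simp_all add: past_def)

definition row_sum :: "real^2^2 \<Rightarrow> 2 \<Rightarrow> real" where
  "row_sum M j = M $ j $ 1 + M $ j $ 2"

text \<open>The parameter \<open>t\<close> at which coordinate \<open>j\<close> of
  \<open>M *v vector [t, t - 1]\<close> changes sign.\<close>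

definition row_share :: "real^2^2 \<Rightarrow> 2 \<Rightarrow> real" where
  "row_share M j = M $ j $ 2 / row_sum M j"

lemma row_sum_mult: "row_sum (M ** N) j = M $ j $ 1 * row_sum N 1 + M $ j $ 2 * row_sum N 2"
  by (simp add: row_sum_def matrix_matrix_mult_def sum_2 algebra_simps)

lemma row_sum_mat_1 [simp]: "row_sum (mat 1) j = 1"
  by (cases j rule: exhaust_2[THEN disjE]) (auto simp: row_sum_def mat_def)

lemma row_share_mat_1: "row_share (mat 1) 1 = 0" "row_share (mat 1) 2 = 1"
  by (simp_all add: row_share_def) (simp_all add: mat_def)

text \<open>
  A direction of the second quadrant is spanned by a unique \<open>(t, t - 1)\<close> with \<open>t \<in> [0, 1]\<close>; in this
  coordinate a positive matrix pulls the quadrant back to the interval between its row shares.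
\<close>

lemma mult_in_second_quadrant_iff:
  assumes "row_sum M 1 > 0" "row_sum M 2 > 0" "invertible M"
  shows "M *v vector [t, t - 1] \<in> second_quadrant \<longleftrightarrow>
    t \<in> closed_segment (row_share M 1) (row_share M 2)"
proof -
  have comp: "(M *v vector [t, t - 1]) $ j = row_sum M j * (t - row_share M j)"
    if "row_sum M j > 0" for j
    using that by (simp add: row_share_def matrix_vector_mult_def sum_2 field_simps)
      (simp add: row_sum_def algebra_simps)
  have "vector [t, t - 1] \<noteq> (0 :: real^2)"
    by (auto simp: vec_eq_iff forall_2)
  then have "M *v vector [t, t - 1] \<noteq> 0"
    using assms(3) by (simp add: invertible_mult_eq_0_iff)
  then have "M *v vector [t, t - 1] \<in> second_quadrant \<longleftrightarrow>
      (row_sum M 1 * row_sum M 2) * ((t - row_share M 1) * (t - row_share M 2)) \<le> 0"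
    using assms by (simp add: second_quadrant_def comp ac_simps)
  also have "\<dots> \<longleftrightarrow> (t - row_share M 1) * (t - row_share M 2) \<le> 0"
    using assms by (simp add: mult_le_0_iff zero_less_mult_iff)
  also have "\<dots> \<longleftrightarrow> t \<in> closed_segment (row_share M 1) (row_share M 2)"
    by (auto simp: closed_segment_eq_real_ivl mult_le_0_iff)
  finally show ?thesis .
qed

lemma second_quadrant_preimage:
  assumes M: "row_sum M 1 > 0" "row_sum M 2 > 0" "invertible M"
    and v: "M *v v \<in> second_quadrant"
  obtains c t where "c \<noteq> 0" "v = c *\<^sub>R vector [t, t - 1]"
    "t \<in> closed_segment (row_share M 1) (row_share M 2)"
proof -
  define c t where "c = v $ 1 - v $ 2" and "t = v $ 1 / c"
  \<comment> \<open>If \<open>c\<close> vanished, \<open>v\<close> would be a multiple of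
    \<open>(1, 1)\<close>, and positive row sums would give its image two coordinates of the same
    strict sign.\<close>
  have "c \<noteq> 0"
  proof
    assume "c = 0"
    then have "(M *v v) $ j = v $ 1 * row_sum M j" for j
      by (simp add: c_def matrix_vector_mult_def sum_2 row_sum_def algebra_simps)
    then have "(M *v v) $ 1 * (M *v v) $ 2 = (v $ 1)\<^sup>2 * (row_sum M 1 * row_sum M 2)"
      by (simp add: power2_eq_square)
    moreover have "v \<noteq> 0"
      using v M(3) by (auto simp: second_quadrant_def)
    with \<open>c = 0\<close> have "v $ 1 \<noteq> 0"
      by (auto simp: c_def vec_eq_iff forall_2)
    ultimately have "(M *v v) $ 1 * (M *v v) $ 2 > 0"
      using M by simp
    then show False using v by (simp add: second_quadrant_def)
  qed
  moreover have v_eq: "v = c *\<^sub>R vector [t, t - 1]"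
    using \<open>c \<noteq> 0\<close> by (auto simp: vec_eq_iff forall_2 t_def c_def field_simps)
  moreover have "M *v vector [t, t - 1] \<in> second_quadrant"
    using v scaleR_second_quadrant_iff[OF \<open>c \<noteq> 0\<close>] unfolding v_eq matrix_vector_mult_scaleR by blast
  ultimately show ?thesis
    using that mult_in_second_quadrant_iff[OF M] by blast
qed

text \<open>The row shares of the product are convex combinations of those of \<open>N\<close>: the
  fraction is the weight of \<open>row_share N 1\<close>. This yields both nesting and contraction
  of the intervals between row shares.\<close>

lemma row_share_mult:
  assumes A: "A $ j $ 1 > 0" "A $ j $ 2 > 0" and N: "row_sum N 1 > 0" "row_sum N 2 > 0"
  shows "row_share (A ** N) j = row_share N 2 +
    A $ j $ 1 * row_sum N 1 / row_sum (A ** N) j * (row_share N 1 - row_share N 2)"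
proof -
  have "row_sum (A ** N) j > 0"
    using A N by (simp add: row_sum_mult add_pos_pos)
  moreover have "(A ** N) $ j $ 2 = A $ j $ 1 * (row_sum N 1 * row_share N 1) + A $ j $ 2 * (row_sum N 2 * row_share N 2)"
    using N by (simp add: row_share_def matrix_matrix_mult_def sum_2)
  ultimately show ?thesis
    unfolding row_share_def[of "A ** N"] by (simp add: field_simps) (simp add: row_sum_mult algebra_simps)
qed

lemma convex_weight_bounds:
  fixes x y K :: real
  assumes "x > 0" "y > 0" "x \<le> K * y" "y \<le> K * x"
  shows "1 / (1 + K) \<le> x / (x + y)" "x / (x + y) \<le> 1 - 1 / (1 + K)"
proof -
  have "K > 0" using assms by (metis mult_le_0_iff not_less order_less_le_trans less_imp_le)
  then show "1 / (1 + K) \<le> x / (x + y)" "x / (x + y) \<le> 1 - 1 / (1 + K)"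
    using assms by (simp_all add: field_simps)
qed

section \<open>Nested intervals for products of positive matrices\<close>

locale positive_matrices =
  fixes A :: "'i::finite \<Rightarrow> real^2^2"
  assumes invertible_A: "invertible (A i)"
    and A_pos: "A i $ j $ k > 0"
begin

abbreviation W :: "'i list \<Rightarrow> real^2^2" where "W \<equiv> word_matrix A"

lemma invertible_W: "invertible (W w)"
proof (induction w)
  case Nil
  then show ?case by (simp add: invertible_def exI[of _ "mat 1"])
next
  case (Cons i w)
  then show ?case using invertible_A by (simp add: invertible_mult)
qed

lemma entry_ratio:
  obtains K where "K \<ge> 1" "\<And>i j k j' k'. A i $ j $ k \<le> K * A i $ j' $ k'"
proof -
  define R where "R = (\<lambda>(i, j, k, j', k'). A i $ j $ k / A i $ j' $ k') ` UNIV"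
  have fin: "finite R" unfolding R_def by simp
  have le: "A i $ j $ k / A i $ j' $ k' \<le> Max R" for i j k j' k'
    by (rule Max_ge[OF fin]) (auto simp: R_def image_iff intro!: exI)
  \<comment> \<open>\<open>undefined\<close> only serves as some letter: the ratio of an entry to
    itself is \<open>1\<close>.\<close>
  have "Max R \<ge> 1"
    using le[of undefined 1 1 1 1] A_pos[of undefined 1 1] by simp
  moreover have "A i $ j $ k \<le> Max R * A i $ j' $ k'" for i j k j' k'
    using le[of i j k j' k'] A_pos[of i j' k'] by (simp add: field_simps)
  ultimately show ?thesis using that by blast
qed

lemma row_sum_W_pos: "row_sum (W w) j > 0"
proof (induction w arbitrary: j)
  case (Cons i w)
  then show ?case using A_pos by (simp add: row_sum_mult add_pos_pos)
qed simp

lemma W_nonneg: "W w $ j $ k \<ge> 0"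
proof (induction w arbitrary: j k)
  case (Cons i w)
  then show ?case using A_pos[of i] by (simp add: matrix_matrix_mult_def sum_2 less_imp_le)
qed (simp add: mat_def)

text \<open>Only the first letter matters. All row sums of \<open>A i ** N\<close> combine the same
  row sums of \<open>N\<close>, with coefficients that agree up to the factor \<open>K\<close>;
  hence the bound does not grow with the word.\<close>

lemma row_sum_ratio:
  assumes K: "K \<ge> 1" "\<And>i j k j' k'. A i $ j $ k \<le> K * A i $ j' $ k'"
  shows "row_sum (W w) j \<le> K * row_sum (W w) j'"
proof (cases w)
  case (Cons i u)
  have "A i $ j $ 1 * row_sum (W u) 1 + A i $ j $ 2 * row_sum (W u) 2
      \<le> (K * A i $ j' $ 1) * row_sum (W u) 1 + (K * A i $ j' $ 2) * row_sum (W u) 2"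
    using K row_sum_W_pos[of u] by (intro add_mono mult_right_mono) (auto simp: less_imp_le)
  then show ?thesis by (simp add: Cons row_sum_mult algebra_simps)
qed (use K in simp)

abbreviation share_segment :: "'i list \<Rightarrow> real set" where
  "share_segment w \<equiv> closed_segment (row_share (W w) 1) (row_share (W w) 2)"

lemma share_segment_Cons: "share_segment (i # w) \<subseteq> share_segment w"
proof -
  have "row_share (W (i # w)) j \<in> share_segment w" for j
  proof -
    define l where "l = A i $ j $ 1 * row_sum (W w) 1 / row_sum (W (i # w)) j"
    have "0 \<le> l" "l \<le> 1"
      using A_pos[of i j] row_sum_W_pos[of w]
      by (auto simp: l_def row_sum_mult add_pos_pos less_imp_le divide_le_eq)
    moreover have "row_share (W (i # w)) j
        = row_share (W w) 2 + l * (row_share (W w) 1 - row_share (W w) 2)"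
      unfolding word_matrix_simps row_share_mult[OF A_pos A_pos row_sum_W_pos row_sum_W_pos] l_def ..
    then have "row_share (W (i # w)) j = (1 - l) * row_share (W w) 2 + l * row_share (W w) 1"
      by (simp add: algebra_simps)
    ultimately show ?thesis
      by (subst closed_segment_commute) (auto simp: in_segment)
  qed
  then show ?thesis by (simp add: closed_segment_subset)
qed

text \<open>Both new shares are convex combinations of the old ones with weights in
  \<open>[\<epsilon>, 1 - \<epsilon>]\<close>. The weights differ by at most
  \<open>1 - 2 * \<epsilon>\<close>, so each letter added on the left contracts the interval by this
  factor.\<close>

lemma share_segment_shrinks:
  obtains \<theta> where "0 \<le> \<theta>" "\<theta> < 1"
    "\<And>w. \<bar>row_share (W w) 1 - row_share (W w) 2\<bar> \<le> \<theta> ^ length w"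
proof -
  obtain K where K: "K \<ge> 1" "\<And>i j k j' k'. A i $ j $ k \<le> K * A i $ j' $ k'"
    by (rule entry_ratio) blast
  \<comment> \<open>The two summands of a row sum of a product agree up to one factor
    \<open>K\<close> from the entries and another one from the row sums.\<close>
  define \<epsilon> where "\<epsilon> = 1 / (1 + K * K)"
  define \<theta> where "\<theta> = 1 - 2 * \<epsilon>"
  have "K * K \<ge> 1" using K(1) by (metis mult_mono' mult_1 zero_le_one)
  then have \<epsilon>: "0 < \<epsilon>" "\<epsilon> \<le> 1 / 2" by (auto simp: \<epsilon>_def field_simps)
  have "\<bar>row_share (W w) 1 - row_share (W w) 2\<bar> \<le> \<theta> ^ length w" for w
  proof (induction w)
    case (Cons i w)
    define l where "l j = A i $ j $ 1 * row_sum (W w) 1 / row_sum (W (i # w)) j" for j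
    have l: "\<epsilon> \<le> l j" "l j \<le> 1 - \<epsilon>" for j
    proof -
      have "A i $ j $ k * row_sum (W w) p \<le> K * K * (A i $ j $ k' * row_sum (W w) p')" for k k' p p'
      proof -
        have "A i $ j $ k * row_sum (W w) p \<le> (K * A i $ j $ k') * (K * row_sum (W w) p')"
          using K A_pos[of i j] row_sum_W_pos[of w] row_sum_ratio[OF K, of w]
          by (intro mult_mono) (auto simp: less_imp_le)
        then show ?thesis by (simp add: ac_simps)
      qed
      then show "\<epsilon> \<le> l j" "l j \<le> 1 - \<epsilon>"
        unfolding l_def \<epsilon>_def word_matrix_simps row_sum_mult
        using A_pos[of i j] row_sum_W_pos[of w]
        by (intro convex_weight_bounds; simp)+
    qed
    have "row_share (W (i # w)) 1 - row_share (W (i # w)) 2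
        = (l 1 - l 2) * (row_share (W w) 1 - row_share (W w) 2)"
      unfolding word_matrix_simps row_share_mult[OF A_pos A_pos row_sum_W_pos row_sum_W_pos] l_def
      by (simp add: algebra_simps)
    moreover have "\<bar>l 1 - l 2\<bar> \<le> \<theta>"
      using l[of 1] l[of 2] by (simp add: \<theta>_def abs_le_iff)
    ultimately show ?case
      using Cons.IH \<epsilon> by (simp add: abs_mult \<theta>_def mult_mono)
  qed (simp add: row_share_mat_1)
  then show ?thesis using that[of \<theta>] \<epsilon> by (auto simp: \<theta>_def)
qed

text \<open>Iterate number \<open>n\<close> composes \<open>n + 1\<close> maps, for the coordinates
  \<open>0\<close> down to \<open>-n\<close>, hence the past of length \<open>Suc n\<close>.\<close>

lemma backward_iterate_mult:
  assumes "v \<noteq> 0"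
  shows "backward_iterate A a n (direction (W (past a (Suc n)) *v v)) = direction v"
proof -
  have "foldr (\<lambda>k. inv_action (A (a (- int k)))) [0..<m] (direction (W (past a m) *v v))
      = direction v" for m
  proof (induction m)
    case (Suc m)
    have "inv_action (A (a (- int m))) (direction (A (a (- int m)) *v (W (past a m) *v v)))
        = direction (W (past a m) *v v)"
      using assms by (intro inv_action_mult) (simp_all add: invertible_A invertible_W invertible_mult_eq_0_iff)
    then show ?case using Suc by (simp add: matrix_vector_mul_assoc)
  qed simp
  then show ?thesis unfolding backward_iterate_def .
qed

text \<open>The intervals of the pasts are nested, compact and shrink to one point \<open>t\<close>.
  Backward iterates of directions in \<open>Q2\<close> stay in them and thus converge to the
  direction of \<open>(t, t - 1)\<close>. As \<open>t\<close> lies in every interval, the limit is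
  carried into the quadrant by every past.\<close>

lemma furstenberg_map_past:
  "W (past a n) *v rep_rp1 (furstenberg_map A a) \<in> second_quadrant"
proof -
  define I where "I n = share_segment (past a n)" for n
  have "decseq I"
    unfolding decseq_Suc_iff I_def past_Suc using share_segment_Cons by blast
  then have "(\<Inter>n. I n) \<noteq> {}"
    by (intro compact_nest) (auto simp: I_def decseq_def)
  then obtain t where t: "\<And>n. t \<in> I n" by blast
  have nz: "vector [t, t - 1] \<noteq> (0 :: real^2)" for t
    by (auto simp: vec_eq_iff forall_2)
  define l where "l = direction (vector [t, t - 1])"
  have lim: "(\<lambda>n. backward_iterate A a n \<theta>) \<longlonglongrightarrow> l" if "\<theta> \<in> Q2" for \<theta>
  proof -
    obtain q where q: "\<theta> = direction q" "q \<in> second_quadrant"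
      using \<open>\<theta> \<in> Q2\<close> by (auto simp: Q2_eq)
    have "\<exists>s \<in> I (Suc n). backward_iterate A a n \<theta> = direction (vector [s, s - 1])" for n
    proof -
      let ?M = "W (past a (Suc n))"
      obtain v where v: "?M *v v = q"
        by (metis invertible_W invertible_right_inverse matrix_right_invertible_surjective surjE)
      obtain c s where cs: "c \<noteq> 0" "v = c *\<^sub>R vector [s, s - 1]" "s \<in> I (Suc n)"
        unfolding I_def
        by (rule second_quadrant_preimage[OF row_sum_W_pos row_sum_W_pos invertible_W,
              of "past a (Suc n)" v]) (use q v in auto)
      have "backward_iterate A a n \<theta> = direction v"
        unfolding q(1) v[symmetric] by (rule backward_iterate_mult) (simp add: cs nz)
      then show ?thesis using cs nz[of s] by (auto simp: direction_scaleR)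
    qed
    then obtain s where s: "\<And>n. s n \<in> I (Suc n)"
      "\<And>n. backward_iterate A a n \<theta> = direction (vector [s n, s n - 1])"
      by metis
    obtain \<kappa> where \<kappa>: "0 \<le> \<kappa>" "\<kappa> < 1"
      "\<And>w. \<bar>row_share (W w) 1 - row_share (W w) 2\<bar> \<le> \<kappa> ^ length w"
      by (rule share_segment_shrinks) blast
    have "s \<longlonglongrightarrow> t"
    proof (rule LIM_zero_cancel, rule Lim_null_comparison)
      show "\<forall>\<^sub>F n in sequentially. norm (s n - t) \<le> \<kappa> ^ Suc n"
      proof (rule always_eventually, rule allI)
        fix n
        have "norm (s n - t) \<le> \<bar>row_share (W (past a (Suc n))) 1 - row_share (W (past a (Suc n))) 2\<bar>"
          using s(1)[of n] t[of "Suc n"] by (auto simp: I_def closed_segment_eq_real_ivl split: if_splits)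
        then show "norm (s n - t) \<le> \<kappa> ^ Suc n"
          using \<kappa>(3)[of "past a (Suc n)"] by simp
      qed
      show "(\<lambda>n. \<kappa> ^ Suc n) \<longlonglongrightarrow> 0"
        using \<kappa> by (intro LIMSEQ_Suc LIMSEQ_power_zero) auto
    qed
    then have "(\<lambda>n. vector [s n, s n - 1] :: real^2) \<longlonglongrightarrow> vector [t, t - 1]"
      by (auto simp: tendsto_vec_iff_2 intro!: tendsto_intros)
    then show ?thesis
      unfolding s(2) l_def by (rule tendsto_direction) (rule nz)+
  qed
  \<comment> \<open>Without a direction in \<open>Q2\<close> the condition under \<open>THE\<close>
    would be vacuous and its solution not unique.\<close>
  have "Q2 \<noteq> {}"
    by (auto simp: Q2_def intro!: exI[of _ "vector [1, 0]"] simp: vec_eq_iff forall_2)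
  then have "furstenberg_map A a = l"
    unfolding furstenberg_map_def using lim
    by (intro the_equality) (auto intro: LIMSEQ_unique)
  moreover obtain c where c: "c \<noteq> 0" "rep_rp1 l = c *\<^sub>R vector [t, t - 1]"
    unfolding l_def by (rule rep_direction[OF nz])
  moreover have "W (past a n) *v vector [t, t - 1] \<in> second_quadrant"
    using t[of n] mult_in_second_quadrant_iff[OF row_sum_W_pos row_sum_W_pos invertible_W]
    by (simp add: I_def)
  ultimately show ?thesis
    by (simp add: matrix_vector_mult_scaleR scaleR_second_quadrant_iff)
qed

end

section \<open>Geometry of the self-affine set\<close>

definition perp :: "real^2 \<Rightarrow> real^2" where
  "perp p = vector [- (p $ 2), p $ 1]"

lemma inner_2: "(x :: real^2) \<bullet> y = x $ 1 * y $ 1 + x $ 2 * y $ 2"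
  by (simp add: inner_vec_def sum_2)

lemma norm_perp [simp]: "norm (perp p) = norm p"
proof -
  have "(norm (perp p))\<^sup>2 = (norm p)\<^sup>2"
    by (simp add: norm_eq_2 perp_def)
  then show ?thesis by simp
qed

lemma perp_decomposition:
  assumes "norm p = 1"
  shows "x = (x \<bullet> p) *\<^sub>R p + (x \<bullet> perp p) *\<^sub>R perp p"
proof -
  have 1: "p $ 1 * p $ 1 + p $ 2 * p $ 2 = 1"
    using norm_eq_2[of p] assms by (simp add: power2_eq_square)
  have "x $ 1 * (p $ 1 * p $ 1 + p $ 2 * p $ 2) = x $ 1"
    "x $ 2 * (p $ 1 * p $ 1 + p $ 2 * p $ 2) = x $ 2"
    unfolding 1 by simp_all
  then show ?thesis
    by (simp add: vec_eq_iff forall_2 inner_2 perp_def algebra_simps)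
qed

text \<open>\<open>x \<bullet> perp p\<close> is the determinant with columns \<open>p\<close> and
  \<open>x\<close>, so this is multiplicativity of determinants. It relates the width of an image
  transversal to \<open>M *v p\<close> to the width of the original set transversal to
  \<open>p\<close>.\<close>

lemma matrix_inner_perp:
  fixes M :: "real^2^2"
  shows "(M *v x) \<bullet> perp (M *v p) = det M * (x \<bullet> perp p)"
  by (simp add: inner_2 perp_def matrix_vector_mult_def sum_2 det_2 algebra_simps)

lemma emeasure_projection:
  assumes "compact E"
  shows "emeasure (lebesgue_perp \<theta>) (projection_along \<theta> ` E)
       = emeasure lborel ((\<lambda>x. x \<bullet> perp (rep_rp1 \<theta>)) ` E)"
proof -
  let ?p = "rep_rp1 \<theta>"
  have proj: "projection_along \<theta> x = (x \<bullet> perp ?p) *\<^sub>R perp ?p" for x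
    using perp_decomposition[of ?p x] by (simp add: projection_along_def algebra_simps)
  have "compact (projection_along \<theta> ` E)"
    unfolding proj using assms by (intro compact_continuous_image continuous_intros)
  then have "projection_along \<theta> ` E \<in> sets borel"
    by (rule borel_compact)
  moreover have "(\<lambda>t. t *\<^sub>R perp ?p) \<in> borel_measurable lborel"
    by measurable
  moreover have "perp ?p \<noteq> 0"
    by (metis norm_perp norm_rep_rp1 norm_zero zero_neq_one)
  then have "(\<lambda>t. t *\<^sub>R perp ?p) -` (projection_along \<theta> ` E) = (\<lambda>x. x \<bullet> perp ?p) ` E"
    by (auto simp: proj)
  ultimately show ?thesis
    unfolding lebesgue_perp_def perp_def[symmetric] by (simp add: emeasure_distr)
qed

text \<open>Each image of an \<open>X i\<close> lies in an interval of radius \<open>r i\<close>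
  around one of its values, which accounts for the factor 2.\<close>

lemma emeasure_image_le_sum:
  fixes f :: "'a \<Rightarrow> real"
  assumes "finite I" "E \<subseteq> (\<Union>i\<in>I. X i)"
    and "\<And>i. i \<in> I \<Longrightarrow> 0 \<le> r i"
    and "\<And>i x y. i \<in> I \<Longrightarrow> x \<in> X i \<Longrightarrow> y \<in> X i \<Longrightarrow> \<bar>f x - f y\<bar> \<le> r i"
  shows "emeasure lborel (f ` E) \<le> ennreal (\<Sum>i\<in>I. 2 * r i)"
proof -
  have "\<exists>J. f ` X i \<subseteq> J \<and> J \<in> sets lborel \<and> emeasure lborel J \<le> ennreal (2 * r i)" if "i \<in> I" for i
  proof (cases "X i = {}")
    case False
    then obtain x where "x \<in> X i" by auto
    then have "f ` X i \<subseteq> {f x - r i .. f x + r i}"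
      using assms(4)[OF that] by (fastforce simp: abs_le_iff)
    moreover have "emeasure lborel {f x - r i .. f x + r i} \<le> ennreal (2 * r i)"
      using assms(3)[OF that] by simp
    ultimately show ?thesis by (intro exI[of _ "{f x - r i .. f x + r i}"]) simp
  qed (auto intro: exI[of _ "{}"])
  then obtain J where J: "\<And>i. i \<in> I \<Longrightarrow> f ` X i \<subseteq> J i" "\<And>i. i \<in> I \<Longrightarrow> J i \<in> sets lborel"
    "\<And>i. i \<in> I \<Longrightarrow> emeasure lborel (J i) \<le> ennreal (2 * r i)"
    by metis
  have "emeasure lborel (f ` E) \<le> emeasure lborel (\<Union>i\<in>I. J i)"
    using assms(1,2) J(1,2) by (intro emeasure_mono) (blast, auto)
  also have "\<dots> \<le> (\<Sum>i\<in>I. emeasure lborel (J i))"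
    using assms(1) J(2) by (intro emeasure_subadditive_finite) auto
  also have "\<dots> \<le> (\<Sum>i\<in>I. ennreal (2 * r i))"
    by (intro sum_mono J)
  also have "\<dots> = ennreal (\<Sum>i\<in>I. 2 * r i)"
    using assms(3) by (intro sum_ennreal) auto
  finally show ?thesis .
qed

section \<open>Contraction and separation of the pieces\<close>

locale positive_ifs = positive_matrices A for A :: "'i::finite \<Rightarrow> real^2^2" +
  fixes d :: "'i \<Rightarrow> real^2" and E :: "(real^2) set"
  assumes onorm_A: "onorm ((*v) (A i)) < 1"
    and attractor: "is_attractor (affine_map A d) E"
    and separation: "strong_separation (affine_map A d) E"
begin

abbreviation s1 :: "'i list \<Rightarrow> real" where "s1 w \<equiv> sing_val1 (W w)"
abbreviation s2 :: "'i list \<Rightarrow> real" where "s2 w \<equiv> sing_val2 (W w)"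

lemma s1_pos: "s1 w > 0" and s2_pos: "s2 w > 0"
  using sing_val_pos[OF invertible_W] by auto

definition contr :: real where "contr = Max (range (\<lambda>i. sing_val1 (A i)))"
definition min_sv :: real where "min_sv = Min (range (\<lambda>i. sing_val2 (A i)))"

lemma sing_val1_A_le: "sing_val1 (A i) \<le> contr"
  unfolding contr_def by (rule Max_ge) auto

lemma contr_pos: "0 < contr" and contr_less_1: "contr < 1"
proof -
  show "0 < contr"
    using sing_val1_A_le sing_val_pos(1)[OF invertible_A] by (metis order_less_le_trans)
  have "sing_val1 (A i) < 1" for i
  proof -
    have "sing_val1 (A i) \<le> onorm ((*v) (A i))"
      by (rule sing_val1_le) (rule onorm[OF matrix_vector_mul_bounded_linear])
    then show ?thesis using onorm_A by (rule order_le_less_trans)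
  qed
  then show "contr < 1" unfolding contr_def by (subst Max_less_iff) auto
qed

lemma sing_val2_A_ge: "min_sv \<le> sing_val2 (A i)"
  unfolding min_sv_def by (rule Min_le) auto

lemma min_sv_pos: "min_sv > 0"
  unfolding min_sv_def using sing_val_pos(2)[OF invertible_A] by (subst Min_gr_iff) auto

lemma s1_le_power: "s1 w \<le> contr ^ length w"
proof (induction w)
  case (Cons i w)
  have "s1 (i # w) \<le> sing_val1 (A i) * s1 w"
    by (simp add: sing_val1_mult_le)
  also have "\<dots> \<le> contr * contr ^ length w"
    using Cons sing_val1_A_le contr_pos by (intro mult_mono) (auto simp: sing_val1_nonneg)
  finally show ?case by simp
qed (simp add: sing_val_mat_1)

lemma s2_append_le: "s2 (u @ v) \<le> contr ^ length v * s2 u"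
proof -
  have "s2 (u @ v) \<le> s2 u * s1 v"
    unfolding word_matrix_append by (rule sing_val2_mult_le[OF invertible_W])
  also have "\<dots> \<le> s2 u * contr ^ length v"
    using s1_le_power s2_pos[of u] by (intro mult_left_mono) auto
  finally show ?thesis by (simp add: mult.commute)
qed

lemma s2_prefix_le: "s2 (u @ v) \<le> s2 u"
proof -
  have "contr ^ length v * s2 u \<le> 1 * s2 u"
    using contr_pos contr_less_1 s2_pos[of u] by (intro mult_right_mono power_le_one) auto
  then show ?thesis using s2_append_le[of u v] by simp
qed

lemma s2_le_power: "s2 w \<le> contr ^ length w"
  using s2_append_le[of "[]" w] by (simp add: sing_val_mat_1)

text \<open>A single further letter costs at most the factor \<open>min_sv\<close>; this keeps words
  cut at scale \<open>\<delta>\<close> above \<open>min_sv * \<delta>\<close>.\<close>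

lemma s2_Cons_ge: "min_sv * s2 w \<le> s2 (i # w)"
proof -
  have "min_sv * s2 w \<le> sing_val2 (A i) * s2 w"
    using sing_val2_A_ge[of i] s2_pos[of w] by (intro mult_right_mono) auto
  also have "\<dots> \<le> s2 (i # w)"
    using sing_val2_mult_ge[of "A i" "W w"] by simp
  finally show ?thesis .
qed

lemma s2_snoc_ge: "min_sv * s2 w \<le> s2 (w @ [i])"
proof -
  have "min_sv * s2 w \<le> sing_val2 (A i) * s2 w"
    using sing_val2_A_ge[of i] s2_pos[of w] by (intro mult_right_mono) auto
  also have "\<dots> \<le> s2 (w @ [i])"
    using sing_val2_mult_ge[of "W w" "A i"] by (simp add: word_matrix_append mult.commute)
  finally show ?thesis .
qed

definition T :: "'i list \<Rightarrow> real^2 \<Rightarrow> real^2" where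
  "T w = foldr (affine_map A d) w"

lemma T_Nil [simp]: "T [] x = x"
  and T_Cons [simp]: "T (i # w) x = affine_map A d i (T w x)"
  and T_append: "T (u @ v) x = T u (T v x)"
  by (simp_all add: T_def)

lemma T_diff: "T w x - T w y = W w *v (x - y)"
  by (induction w) (simp_all add: affine_map_def matrix_vector_mul_assoc[symmetric]
      matrix_vector_mult_diff_distrib[symmetric])

lemma compact_E: "compact E" and E_nonempty: "E \<noteq> {}"
  and E_eq: "E = (\<Union>i. affine_map A d i ` E)"
  using attractor by (simp_all add: is_attractor_def)

lemma T_in_E: "x \<in> E \<Longrightarrow> T w x \<in> E"
proof (induction w)
  case (Cons i w)
  then show ?case using E_eq by (metis T_Cons UN_I UNIV_I imageI)
qed simp

lemma E_subset_words: "E \<subseteq> (\<Union>w\<in>{w. length w = n}. T w ` E)"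
proof (induction n)
  case (Suc n)
  show ?case
  proof
    fix x assume "x \<in> E"
    then have "x \<in> (\<Union>i. affine_map A d i ` E)" using E_eq by blast
    then obtain i y where y: "y \<in> E" "x = affine_map A d i y" by blast
    then obtain w z where "length w = n" "z \<in> E" "y = T w z" using Suc by auto
    then show "x \<in> (\<Union>w\<in>{w. length w = Suc n}. T w ` E)"
      by (auto simp: y(2) intro!: exI[of _ "i # w"])
  qed
qed auto

text \<open>Disjoint compact sets have positive distance, and there are finitely many pairs of
  letters.\<close>

lemma separation_distance:
  obtains \<rho> where "\<rho> > 0"
    "\<And>i j x y. i \<noteq> j \<Longrightarrow> x \<in> E \<Longrightarrow> y \<in> E \<Longrightarrow> \<rho> \<le> dist (affine_map A d i x) (affine_map A d j y)"
proof -
  have "\<exists>r>0. i \<noteq> j \<longrightarrow> (\<forall>x\<in>E. \<forall>y\<in>E. r \<le> dist (affine_map A d i x) (affine_map A d j y))" for i j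
  proof (cases "i = j")
    case False
    have "compact (affine_map A d k ` E)" for k
      unfolding affine_map_def[abs_def] using compact_E
      by (intro compact_continuous_image continuous_intros linear_continuous_on
          matrix_vector_mul_bounded_linear)
    moreover have "affine_map A d i ` E \<inter> affine_map A d j ` E = {}"
      using separation False by (auto simp: strong_separation_def disjoint_family_on_def)
    ultimately obtain r where "r > 0"
      "\<forall>x\<in>affine_map A d i ` E. \<forall>y\<in>affine_map A d j ` E. r \<le> dist x y"
      using separate_compact_closed compact_imp_closed by metis
    then show ?thesis by auto
  qed (auto intro: exI[of _ 1])
  then obtain r where r: "\<And>i j. r i j > 0" "\<And>i j x y. i \<noteq> j \<Longrightarrow> x \<in> E \<Longrightarrow> y \<in> E \<Longrightarrow>
      r i j \<le> dist (affine_map A d i x) (affine_map A d j y)"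
    by metis
  let ?\<rho> = "Min (range (\<lambda>(i, j). r i j))"
  have "?\<rho> > 0" using r(1) by (subst Min_gr_iff) auto
  moreover have "?\<rho> \<le> r i j" for i j by (rule Min_le) (auto intro: rev_image_eqI[of "(i, j)"])
  ultimately show ?thesis using that r(2) by (meson order_trans)
qed

text \<open>After the longest common prefix \<open>u\<close> the two points lie in different
  first-level pieces, at distance at least \<open>\<rho>\<close>. Applying \<open>T u\<close>
  shrinks this by no more than \<open>s2 u\<close>, which is at least \<open>s2 w\<close>.\<close>

lemma parallel_separated:
  assumes \<rho>: "\<rho> > 0" "\<And>i j x y. i \<noteq> j \<Longrightarrow> x \<in> E \<Longrightarrow> y \<in> E \<Longrightarrow>
      \<rho> \<le> dist (affine_map A d i x) (affine_map A d j y)"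
    and w: "w \<parallel> w'" "\<epsilon> \<le> s2 w" and xy: "x \<in> E" "y \<in> E"
  shows "\<rho> * \<epsilon> \<le> dist (T w x) (T w' y)"
proof -
  obtain u i v j v' where u: "i \<noteq> j" "w = u @ i # v" "w' = u @ j # v'"
    using parallel_decomp[OF w(1)] by blast
  let ?x = "T (i # v) x" and ?y = "T (j # v') y"
  have "\<epsilon> * \<rho> \<le> s2 u * dist ?x ?y"
    using w(2) s2_prefix_le[of u "i # v"] s2_pos[of u] \<rho> u xy T_in_E
    by (intro mult_mono) auto
  also have "\<dots> \<le> dist (T w x) (T w' y)"
    using sing_val2_norm_ge[of "W u" "?x - ?y"] unfolding u T_append dist_norm T_diff .
  finally show ?thesis by (simp add: mult.commute)
qed

text \<open>A set this small cannot meet the pieces of two incomparable words, so the words form a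
  chain of prefixes. Since their \<open>s2\<close> agree up to the factor \<open>min_sv\<close> and
  every letter contracts, the lengths in the chain vary by a bounded amount.\<close>

lemma multiplicity_bound:
  obtains \<rho> L where "\<rho> > 0"
    "\<And>Z U \<delta>. finite Z \<Longrightarrow> \<delta> > 0 \<Longrightarrow> bounded U \<Longrightarrow> diameter U \<le> \<rho> * \<delta> \<Longrightarrow>
      (\<And>w. w \<in> Z \<Longrightarrow> min_sv * \<delta> \<le> s2 w \<and> s2 w \<le> \<delta> \<and> U \<inter> T w ` E \<noteq> {}) \<Longrightarrow> card Z \<le> Suc L"
proof -
  obtain \<rho> where \<rho>: "\<rho> > 0" "\<And>i j x y. i \<noteq> j \<Longrightarrow> x \<in> E \<Longrightarrow> y \<in> E \<Longrightarrow>
      \<rho> \<le> dist (affine_map A d i x) (affine_map A d j y)"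
    by (rule separation_distance) blast
  obtain L where L: "contr ^ L < min_sv"
    using real_arch_pow_inv[OF min_sv_pos contr_less_1] by blast
  have "card Z \<le> Suc L"
    \<comment> \<open>Half the gap \<open>\<rho> * min_sv * \<delta>\<close> between incomparable
      pieces, so that the contradiction below is strict.\<close>
    if fin: "finite Z" and \<delta>: "\<delta> > 0" and U: "bounded U" "diameter U \<le> (\<rho> * min_sv / 2) * \<delta>"
      and Z: "\<And>w. w \<in> Z \<Longrightarrow> min_sv * \<delta> \<le> s2 w \<and> s2 w \<le> \<delta> \<and> U \<inter> T w ` E \<noteq> {}" for Z U \<delta>
  proof (cases "Z = {}")
    case False
    have comparable: "prefix w w' \<or> prefix w' w" if w: "w \<in> Z" "w' \<in> Z" for w w'
    proof (rule ccontr)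
      assume "\<not> ?thesis"
      then have "w \<parallel> w'" by (auto intro: parallelI)
      obtain x y where xy: "x \<in> E" "T w x \<in> U" "y \<in> E" "T w' y \<in> U"
        using Z[OF w(1)] Z[OF w(2)] by auto
      have "\<rho> * (min_sv * \<delta>) \<le> dist (T w x) (T w' y)"
        using parallel_separated[OF \<rho> \<open>w \<parallel> w'\<close>] Z[OF w(1)] xy by blast
      also have "\<dots> \<le> (\<rho> * min_sv / 2) * \<delta>"
        using diameter_bounded_bound[OF U(1) xy(2,4)] U(2) by linarith
      finally show False using \<rho>(1) min_sv_pos \<delta> by (simp add: field_simps)
    qed
    \<comment> \<open>Comparable words of equal length coincide, so the chain can be counted by its
      lengths.\<close>
    have inj: "inj_on length Z"
      using comparable by (intro inj_onI) (fastforce simp: prefix_def)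
    define m where "m = Min (length ` Z)"
    have "length ` Z \<subseteq> {m..<m + Suc L}"
    proof
      fix l assume "l \<in> length ` Z"
      then obtain w' where w': "w' \<in> Z" "l = length w'" by auto
      have "m \<in> length ` Z" unfolding m_def using fin False by (intro Min_in) auto
      then obtain w where w: "w \<in> Z" "m = length w" by auto
      have "m \<le> l" unfolding m_def w' using fin w' by (intro Min_le) auto
      then have "prefix w w'"
        using comparable[OF w(1) w'(1)] w w' by (auto simp: prefix_def)
      then obtain v where v: "w' = w @ v" by (auto simp: prefix_def)
      have "min_sv * \<delta> \<le> contr ^ length v * s2 w"
        using Z[OF w'(1)] s2_append_le[of w v] v by auto
      also have "\<dots> \<le> contr ^ length v * \<delta>"
        using Z[OF w(1)] contr_pos by (intro mult_left_mono) auto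
      finally have "contr ^ L < contr ^ length v" using \<delta> L by simp
      then have "length v < L"
        using contr_pos contr_less_1 by (simp add: power_strict_decreasing_iff)
      then show "l \<in> {m..<m + Suc L}" using v w w' by auto
    qed
    then have "card Z \<le> card {m..<m + Suc L}"
      by (intro card_inj_on_le[OF inj]) auto
    then show ?thesis by simp
  qed simp
  then show ?thesis
    using that[of "\<rho> * min_sv / 2" L] \<rho>(1) min_sv_pos by auto
qed

text \<open>Cramer's rule recovers \<open>p\<close> from \<open>q = M *v p\<close>. The coordinates
  of \<open>q\<close> have opposite signs and the entries of \<open>M\<close> are nonnegative, so
  nothing cancels, and \<open>\<bar>det M\<bar>\<close> dominates a multiple of
  \<open>s1 w * norm q\<close>. Dividing by \<open>s1 w\<close> leaves \<open>s2 w\<close>.\<close>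

lemma norm_mult_le_of_second_quadrant:
  obtains C where "C > 0"
    "\<And>w p. norm p = 1 \<Longrightarrow> W w *v p \<in> second_quadrant \<Longrightarrow> norm (W w *v p) \<le> C * s2 w"
proof -
  obtain K where K: "K \<ge> 1" "\<And>i j k j' k'. A i $ j $ k \<le> K * A i $ j' $ k'"
    by (rule entry_ratio) blast
  have "norm (W w *v p) \<le> (2 * (1 + K)) * s2 w"
    if p: "norm p = 1" and q: "W w *v p \<in> second_quadrant" for w p
  proof -
    define M where "M = W w"
    define q where "q = M *v p"
    have M0: "M $ j $ k \<ge> 0" for j k unfolding M_def by (rule W_nonneg)
    have q12: "q $ 1 * q $ 2 \<le> 0" using q by (simp add: second_quadrant_def q_def M_def)
    have split: "\<bar>x * q $ 1 - y * q $ 2\<bar> = x * \<bar>q $ 1\<bar> + y * \<bar>q $ 2\<bar>" if "x \<ge> 0" "y \<ge> 0" for x y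
    proof -
      consider "q $ 1 \<ge> 0" "q $ 2 \<le> 0" | "q $ 1 \<le> 0" "q $ 2 \<ge> 0"
        using q12 by (auto simp: mult_le_0_iff)
      then show ?thesis
      proof cases
        case 1
        then have "x * q $ 1 \<ge> 0" "y * q $ 2 \<le> 0" using that by (auto simp: mult_nonneg_nonpos)
        then show ?thesis using 1 by simp
      next
        case 2
        then have "x * q $ 1 \<le> 0" "y * q $ 2 \<ge> 0" using that by (auto simp: mult_nonneg_nonpos)
        then show ?thesis using 2 by simp
      qed
    qed
    have "det M * p $ 1 = M$2$2 * q $ 1 - M$1$2 * q $ 2"
      "- (det M * p $ 2) = M$2$1 * q $ 1 - M$1$1 * q $ 2"
      by (simp_all add: q_def matrix_vector_mult_def sum_2 det_2 algebra_simps)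
    then have "\<bar>det M\<bar> * \<bar>p $ 1\<bar> = M$2$2 * \<bar>q $ 1\<bar> + M$1$2 * \<bar>q $ 2\<bar>"
      "\<bar>det M\<bar> * \<bar>p $ 2\<bar> = M$2$1 * \<bar>q $ 1\<bar> + M$1$1 * \<bar>q $ 2\<bar>"
      using split[OF M0 M0] by (metis abs_mult abs_minus_cancel)+
    then have eq: "\<bar>det M\<bar> * (\<bar>p $ 1\<bar> + \<bar>p $ 2\<bar>) = row_sum M 2 * \<bar>q $ 1\<bar> + row_sum M 1 * \<bar>q $ 2\<bar>"
      by (simp add: row_sum_def algebra_simps)
    have "s1 w \<le> row_sum M 1 + row_sum M 2"
      using sing_val1_le_entries[of M] M0 by (simp add: M_def row_sum_def)
    moreover have "row_sum M 1 + row_sum M 2 \<le> row_sum M j + K * row_sum M j" for j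
      using exhaust_2[of j] row_sum_ratio[OF K, of w 1 2] row_sum_ratio[OF K, of w 2 1]
      by (auto simp: M_def)
    ultimately have rs: "s1 w \<le> (1 + K) * row_sum M j" for j
      by (simp add: distrib_right order_trans)
    have "s1 w * norm q \<le> s1 w * (\<bar>q $ 1\<bar> + \<bar>q $ 2\<bar>)"
      using norm_le_l1_cart[of q] s1_pos[of w] by (simp add: sum_2)
    also have "\<dots> \<le> ((1 + K) * row_sum M 2) * \<bar>q $ 1\<bar> + ((1 + K) * row_sum M 1) * \<bar>q $ 2\<bar>"
      unfolding distrib_left by (intro add_mono mult_right_mono rs) auto
    also have "\<dots> = (1 + K) * (\<bar>det M\<bar> * (\<bar>p $ 1\<bar> + \<bar>p $ 2\<bar>))"
      unfolding eq by (simp add: algebra_simps)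
    also have "\<dots> \<le> (1 + K) * (\<bar>det M\<bar> * 2)"
      using component_le_norm_cart[of p 1] component_le_norm_cart[of p 2] K p
      by (intro mult_left_mono) auto
    also have "\<dots> = s1 w * ((2 * (1 + K)) * s2 w)"
      unfolding M_def sing_val_mult[symmetric] by simp
    finally show ?thesis using s1_pos[of w] by (simp add: q_def M_def)
  qed
  then show ?thesis using that[of "2 * (1 + K)"] K by auto
qed

text \<open>The sets meeting the image of \<open>E\<close> under \<open>T w\<close> pull back to a
  cover of \<open>E\<close>. Since \<open>W w\<close> shrinks \<open>p\<close> to length at most
  \<open>C * s2 w\<close>, each pulled back set has width at most
  \<open>\<epsilon> * C / s1 w\<close> transversal to \<open>p\<close>, while the total width is at
  least \<open>\<eta>\<close>.\<close>

lemma card_meeting_ge: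
  assumes C: "\<And>w p. norm p = 1 \<Longrightarrow> W w *v p \<in> second_quadrant \<Longrightarrow> norm (W w *v p) \<le> C * s2 w"
    and p: "norm p = 1" "W w *v p \<in> second_quadrant"
    and \<eta>: "ennreal \<eta> \<le> emeasure lborel ((\<lambda>x. x \<bullet> perp p) ` E)"
    and F: "finite F" "E \<subseteq> \<Union>F" "\<And>U. U \<in> F \<Longrightarrow> bounded U \<and> diameter U \<le> \<epsilon>" and \<epsilon>: "\<epsilon> > 0"
  shows "\<eta> * s1 w \<le> 2 * \<epsilon> * C * card {U \<in> F. U \<inter> T w ` E \<noteq> {}}"
proof -
  let ?F = "{U \<in> F. U \<inter> T w ` E \<noteq> {}}"
  define r where "r = \<epsilon> * C / s1 w"
  have "0 \<le> norm (W w *v p)" by simp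
  then have "0 \<le> C * s2 w" using C[OF p] by linarith
  then have "C \<ge> 0" using s2_pos[of w] by (simp add: zero_le_mult_iff)
  have "emeasure lborel ((\<lambda>x. x \<bullet> perp p) ` E) \<le> ennreal (\<Sum>U\<in>?F. 2 * r)"
  proof (rule emeasure_image_le_sum[where f = "\<lambda>x. x \<bullet> perp p" and E = E and I = ?F and
        X = "\<lambda>U. {x \<in> E. T w x \<in> U}" and r = "\<lambda>_. r"])
    show "E \<subseteq> (\<Union>U\<in>?F. {x \<in> E. T w x \<in> U})"
    proof
      fix x assume "x \<in> E"
      then have "T w x \<in> \<Union>F" by (intro subsetD[OF F(2)] T_in_E)
      with \<open>x \<in> E\<close> show "x \<in> (\<Union>U\<in>?F. {x \<in> E. T w x \<in> U})" by auto
    qed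
    show "0 \<le> r" using \<epsilon> \<open>C \<ge> 0\<close> s1_pos[of w] by (simp add: r_def)
    fix U x y assume U: "U \<in> ?F" and xy: "x \<in> {x \<in> E. T w x \<in> U}" "y \<in> {x \<in> E. T w x \<in> U}"
    \<comment> \<open>The product of the singular values is the absolute determinant in
      \<open>matrix_inner_perp\<close>; the factor \<open>s2 w\<close> will cancel against the one
      in the bound for \<open>W w *v p\<close>.\<close>
    have "s1 w * s2 w * \<bar>x \<bullet> perp p - y \<bullet> perp p\<bar> = \<bar>(W w *v (x - y)) \<bullet> perp (W w *v p)\<bar>"
      unfolding matrix_inner_perp abs_mult sing_val_mult by (simp add: inner_diff_left)
    also have "\<dots> \<le> norm (W w *v (x - y)) * norm (W w *v p)"
      using Cauchy_Schwarz_ineq2[of "W w *v (x - y)" "perp (W w *v p)"] by simp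
    also have "\<dots> \<le> \<epsilon> * (C * s2 w)"
    proof (rule mult_mono)
      have "norm (W w *v (x - y)) = dist (T w x) (T w y)"
        by (simp add: dist_norm T_diff)
      also have "\<dots> \<le> \<epsilon>"
        using F(3)[of U] U xy diameter_bounded_bound[of U "T w x" "T w y"] by auto
      finally show "norm (W w *v (x - y)) \<le> \<epsilon>" .
    qed (use C[OF p] \<epsilon> in auto)
    finally have "s2 w * (s1 w * \<bar>x \<bullet> perp p - y \<bullet> perp p\<bar>) \<le> s2 w * (\<epsilon> * C)"
      by (simp add: ac_simps)
    then show "\<bar>x \<bullet> perp p - y \<bullet> perp p\<bar> \<le> r"
      using s1_pos[of w] s2_pos[of w] by (simp add: r_def field_simps)
  qed (use F(1) in simp)
  then have "ennreal \<eta> \<le> ennreal (card ?F * (2 * r))"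
    using \<eta> by simp
  then have "\<eta> \<le> card ?F * (2 * r)"
    using \<epsilon> \<open>C \<ge> 0\<close> s1_pos[of w] by (subst (asm) ennreal_le_iff) (auto simp: r_def)
  then show ?thesis
    using s1_pos[of w] by (simp add: r_def field_simps)
qed

text \<open>\<open>E\<close> is cut by a rectangular grid along the direction \<open>p\<close> of
  least stretch and its normal, with cells that \<open>W w\<close> maps to sets of diameter at most
  \<open>\<delta>\<close>. Along \<open>p\<close> boundedly many cells suffice because
  \<open>s2 w \<le> \<delta>\<close>; along the normal their number is of order
  \<open>s1 w / \<delta>\<close>.\<close>

lemma cover_word_image:
  obtains C where "C > 0" "\<And>w \<delta>. \<delta> > 0 \<Longrightarrow> min_sv * \<delta> \<le> s2 w \<Longrightarrow> s2 w \<le> \<delta> \<Longrightarrow>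
    \<exists>F. finite F \<and> card F \<le> C * s1 w / \<delta> \<and> T w ` E \<subseteq> \<Union>F \<and> (\<forall>U\<in>F. bounded U \<and> diameter U \<le> \<delta>)"
proof -
  obtain R0 where R0: "\<And>x. x \<in> E \<Longrightarrow> norm x \<le> R0"
    using compact_imp_bounded[OF compact_E] by (auto simp: bounded_iff)
  define R where "R = max R0 1"
  have R: "R \<ge> 1" "\<And>x. x \<in> E \<Longrightarrow> norm x \<le> R" using R0 by (fastforce simp: R_def)+
  define C where "C = (4 * R + 3 / min_sv) * (4 * R + 3)"
  have "\<exists>F. finite F \<and> card F \<le> C * s1 w / \<delta> \<and> T w ` E \<subseteq> \<Union>F \<and> (\<forall>U\<in>F. bounded U \<and> diameter U \<le> \<delta>)"
    if \<delta>: "\<delta> > 0" "min_sv * \<delta> \<le> s2 w" "s2 w \<le> \<delta>" for w \<delta>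
  proof -
    obtain v where v: "v \<noteq> 0" "norm (W w *v v) = s2 w * norm v"
      by (rule sing_val2_attained)
    define p where "p = v /\<^sub>R norm v"
    have p: "norm p = 1" "norm (W w *v p) = s2 w"
      using v by (simp_all add: p_def matrix_vector_mult_scaleR)
    \<comment> \<open>Reciprocals of the cell sides, chosen so that each side contributes at most
      \<open>\<delta> / 2\<close> to the diameter of the image.\<close>
    define a b where "a = 2 * s1 w / \<delta>" and "b = 2 * s2 w / \<delta>"
    define f where "f x = (\<lfloor>(x \<bullet> perp p) * a\<rfloor>, \<lfloor>(x \<bullet> p) * b\<rfloor>)" for x
    define box where "box r = {- \<lceil>R * r\<rceil> .. \<lceil>R * r\<rceil>}" for r
    have ab: "a > 0" "b > 0" "b \<le> 2" using s1_pos[of w] s2_pos[of w] \<delta> by (auto simp: a_def b_def field_simps)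
    have floor_box: "\<lfloor>t * r\<rfloor> \<in> box r" if "\<bar>t\<bar> \<le> R" "r > 0" for t r
    proof -
      have "\<bar>t * r\<bar> \<le> R * r" using that by (simp add: abs_mult)
      then show ?thesis unfolding box_def by (auto simp: abs_le_iff le_floor_iff) linarith+
    qed
    have card_box: "card (box r) \<le> 2 * (R * r) + 3" if "r > 0" for r
    proof -
      have "R * r \<ge> 0" using R(1) that by simp
      then have "\<lceil>R * r\<rceil> \<ge> 0" by linarith
      then show ?thesis unfolding box_def by (simp add: of_nat_nat) linarith
    qed
    have in_box: "f x \<in> box a \<times> box b" if "x \<in> E" for x
    proof -
      have "\<bar>x \<bullet> perp p\<bar> \<le> R" "\<bar>x \<bullet> p\<bar> \<le> R"
        using Cauchy_Schwarz_ineq2[of x "perp p"] Cauchy_Schwarz_ineq2[of x p] p R(2)[OF that] by auto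
      then show ?thesis using ab floor_box by (simp add: f_def)
    qed
    define F where "F = (\<lambda>k. T w ` {x \<in> E. f x = k}) ` (box a \<times> box b)"
    have fin: "finite (box a \<times> box b)" by (simp add: box_def)
    have "finite F" using fin by (simp add: F_def)
    moreover have "card F \<le> C * s1 w / \<delta>"
    proof -
      have "card F \<le> card (box a \<times> box b)"
        unfolding F_def by (rule card_image_le[OF fin])
      then have "real (card F) \<le> real (card (box a)) * real (card (box b))"
        by (simp add: card_cartesian_product flip: of_nat_mult)
      also have "\<dots> \<le> (2 * (R * a) + 3) * (2 * (R * b) + 3)"
        using card_box ab R by (intro mult_mono) auto
      also have "\<dots> \<le> ((4 * R + 3 / min_sv) * s1 w / \<delta>) * (4 * R + 3)"
      proof (rule mult_mono)
        \<comment> \<open>Allows the additive 3 to be absorbed into a multiple of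
          \<open>s1 w / \<delta>\<close>.\<close>
        have "min_sv * \<delta> \<le> s1 w" using \<delta>(2) sing_val2_le_sing_val1[of "W w"] by linarith
        then show "2 * (R * a) + 3 \<le> (4 * R + 3 / min_sv) * s1 w / \<delta>"
          using \<delta> min_sv_pos by (simp add: a_def field_simps)
        show "2 * (R * b) + 3 \<le> 4 * R + 3" using ab R by simp
      qed (use ab R s1_pos[of w] \<delta> min_sv_pos in auto)
      finally show ?thesis by (simp add: C_def ac_simps)
    qed
    moreover have "T w ` E \<subseteq> \<Union>F" using in_box by (auto simp: F_def)
    moreover have "bounded U \<and> diameter U \<le> \<delta>" if U: "U \<in> F" for U
    proof -
      obtain k where k: "U = T w ` {x \<in> E. f x = k}" using U by (auto simp: F_def)
      have "U \<subseteq> E" using k T_in_E by auto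
      then have "bounded U" using compact_imp_bounded[OF compact_E] bounded_subset by blast
      moreover have "diameter U \<le> \<delta>"
      proof (rule diameter_le)
        fix x' y' assume "x' \<in> U" "y' \<in> U"
        then obtain x y where xy: "x' = T w x" "y' = T w y" "f x = f y" using k by auto
        have close: "\<bar>s - t\<bar> \<le> 1 / r" if "\<lfloor>s * r\<rfloor> = \<lfloor>t * r\<rfloor>" "r > 0" for s t r :: real
        proof -
          have "\<bar>s * r - t * r\<bar> \<le> 1" using that(1) by linarith
          then have "\<bar>s - t\<bar> * r \<le> 1" using that(2) by (simp add: abs_mult left_diff_distrib[symmetric])
          then show ?thesis using that(2) by (simp add: field_simps)
        qed
        let ?z = "x - y"
        have z: "\<bar>?z \<bullet> perp p\<bar> \<le> 1 / a" "\<bar>?z \<bullet> p\<bar> \<le> 1 / b"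
          using xy(3) ab close by (auto simp: f_def inner_diff_left)
        have "norm (x' - y') = norm (W w *v ((?z \<bullet> p) *\<^sub>R p + (?z \<bullet> perp p) *\<^sub>R perp p))"
          using perp_decomposition[OF p(1), of ?z] by (simp add: xy T_diff)
        also have "\<dots> \<le> \<bar>?z \<bullet> p\<bar> * norm (W w *v p) + \<bar>?z \<bullet> perp p\<bar> * norm (W w *v perp p)"
          by (simp add: matrix_vector_right_distrib matrix_vector_mult_scaleR order_trans[OF norm_triangle_ineq])
        also have "\<dots> \<le> 1 / b * s2 w + 1 / a * s1 w"
          using z p sing_val1_norm_le[of "W w" "perp p"] ab s2_pos[of w]
          by (intro add_mono mult_mono) auto
        also have "\<dots> = \<delta>"
          using s1_pos[of w] s2_pos[of w] by (simp add: a_def b_def)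
        finally show "norm (x' - y') \<le> \<delta>" .
      qed (use \<delta> in auto)
      ultimately show ?thesis ..
    qed
    ultimately show ?thesis by blast
  qed
  moreover have "C > 0" using R min_sv_pos by (simp add: C_def add_pos_pos)
  ultimately show ?thesis using that by blast
qed

end

section \<open>Cylinders and the upper bound\<close>

lemma ennreal_pos_obtain:
  assumes "(x :: ennreal) > 0"
  obtains r where "r > 0" "ennreal r \<le> x"
proof (cases x)
  case (real r)
  then show ?thesis using that[of r] assms by auto
next
  case top
  then show ?thesis using that[of 1] by auto
qed

text \<open>After taking logarithms a multiplicative constant \<open>k\<close> contributes only
  \<open>ln k / - ln \<delta>\<close>, which tends to zero.\<close>

lemma box_dim_of_power_bounds:
  assumes c: "c > 0" "C > 0"
    and lower: "\<forall>\<^sub>F \<delta> in at_right 0. c * \<delta> powr (- s) \<le> covering_number E \<delta>"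
    and upper: "\<forall>\<^sub>F \<delta> in at_right 0. covering_number E \<delta> \<le> C * \<delta> powr (- s)"
  shows "has_box_dim E s"
  unfolding has_box_dim_def
proof (rule tendsto_sandwich)
  have small: "\<forall>\<^sub>F \<delta> in at_right 0. 0 < \<delta> \<and> \<delta> < (1 :: real)"
    by (auto simp: eventually_at_right_field intro!: exI[of _ 1])
  have rewrite: "s + ln k / - ln \<delta> = ln (k * \<delta> powr (- s)) / - ln \<delta>" if "k > 0" "0 < \<delta>" "\<delta> < 1" for k \<delta>
    using that by (simp add: ln_mult ln_powr field_simps)
  show "\<forall>\<^sub>F \<delta> in at_right 0. s + ln c / - ln \<delta> \<le> ln (real (covering_number E \<delta>)) / - ln \<delta>"
    using small lower
  proof eventually_elim
    case (elim \<delta>)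
    then have "0 < c * \<delta> powr (- s)" using c by simp
    then have "ln (c * \<delta> powr (- s)) \<le> ln (real (covering_number E \<delta>))"
      using elim by (intro ln_mono) auto
    then show ?case using elim rewrite[OF c(1)] by (simp add: divide_right_mono_neg)
  qed
  show "\<forall>\<^sub>F \<delta> in at_right 0. ln (real (covering_number E \<delta>)) / - ln \<delta> \<le> s + ln C / - ln \<delta>"
    using small lower upper
  proof eventually_elim
    case (elim \<delta>)
    then have "0 < c * \<delta> powr (- s)" using c by simp
    then have "0 < real (covering_number E \<delta>)" using elim by linarith
    then have "ln (real (covering_number E \<delta>)) \<le> ln (C * \<delta> powr (- s))"
      using elim by (intro ln_mono) auto
    then show ?case using elim rewrite[OF c(2)] by (simp add: divide_right_mono_neg)
  qed
  show "((\<lambda>\<delta>. s + ln c / - ln \<delta>) \<longlongrightarrow> s) (at_right 0)"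
    by real_asymp
  show "((\<lambda>\<delta>. s + ln C / - ln \<delta>) \<longlongrightarrow> s) (at_right 0)"
    by real_asymp
qed

lemma covering_number_le:
  assumes "finite F" "E \<subseteq> \<Union>F" "\<forall>U\<in>F. bounded U \<and> diameter U \<le> \<delta>"
  shows "covering_number E \<delta> \<le> card F"
  unfolding covering_number_def using assms by (intro Least_le) auto

lemma covering_number_attained:
  assumes "finite F" "E \<subseteq> \<Union>F" "\<forall>U\<in>F. bounded U \<and> diameter U \<le> \<delta>"
  obtains G where "finite G" "card G = covering_number E \<delta>" "E \<subseteq> \<Union>G"
    "\<And>U. U \<in> G \<Longrightarrow> bounded U \<and> diameter U \<le> \<delta>"
proof -
  have "\<exists>G. finite G \<and> card G = covering_number E \<delta> \<and> E \<subseteq> \<Union>G \<and> (\<forall>U\<in>G. bounded U \<and> diameter U \<le> \<delta>)"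
    unfolding covering_number_def
    by (rule LeastI[where P = "\<lambda>n. \<exists>F. finite F \<and> card F = n \<and> E \<subseteq> \<Union>F \<and> (\<forall>U\<in>F. bounded U \<and> diameter U \<le> \<delta>)"])
      (use assms in blast)
  then show ?thesis using that by blast
qed

section \<open>Cylinders in the one-sided and two-sided shift\<close>

lemma past_nth: "k < n \<Longrightarrow> past a n ! k = a (int k + 1 - int n)"
  by (simp add: past_def rev_nth of_nat_diff algebra_simps)

lemma measurable_cylinder: "cylinder w \<in> sets (one_sided :: (nat \<Rightarrow> 'i) measure)" for w :: "'i list"
proof -
  have "(\<lambda>x. x k) \<in> measurable (one_sided :: (nat \<Rightarrow> 'i) measure) (count_space UNIV)" for k
    unfolding one_sided_def by (rule measurable_component_singleton) simp
  from measurable_sets[OF this, of "{w ! k}" for k]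
  have "{x. x k = w ! k} \<in> sets (one_sided :: (nat \<Rightarrow> 'i) measure)" for k
    by (simp add: one_sided_def space_PiM vimage_def)
  moreover have "UNIV \<in> sets (one_sided :: (nat \<Rightarrow> 'i) measure)"
    using sets.top[of "one_sided :: (nat \<Rightarrow> 'i) measure"] by (simp add: one_sided_def space_PiM)
  ultimately have "(\<Inter>k\<in>{..<length w}. {x. x k = w ! k}) \<in> sets (one_sided :: (nat \<Rightarrow> 'i) measure)"
    by (intro sets.countable_INT'') auto
  also have "(\<Inter>k\<in>{..<length w}. {x. x k = w ! k}) = cylinder w"
    by (auto simp: cylinder_def)
  finally show ?thesis .
qed

lemma cylinder_disjoint:
  assumes "\<not> prefix w w'" "\<not> prefix w' w"
  shows "cylinder w \<inter> cylinder w' = {}"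
proof -
  have "prefix u v" if "x \<in> cylinder u" "x \<in> cylinder v" "length u \<le> length v" for u v :: "'a list" and x
  proof -
    have "u = take (length u) v"
      using that by (intro nth_equalityI) (auto simp: cylinder_def)
    then show ?thesis by (metis take_is_prefix)
  qed
  then show ?thesis using assms by (metis disjoint_iff nle_le)
qed

text \<open>Prescribes the coordinates \<open>1 - j\<close> up to \<open>length w - j\<close>:
  \<open>j = 0\<close> gives the positive cylinder, and \<open>j = length w\<close> a window ending
  at coordinate \<open>0\<close>, that is a condition on the past.\<close>

definition shifted_cylinder :: "nat \<Rightarrow> 'i list \<Rightarrow> (int \<Rightarrow> 'i) set" where
  "shifted_cylinder j w = {a. \<forall>k < length w. a (int k + 1 - int j) = w ! k}"

lemma past_eq_iff: "past a (length w) = w \<longleftrightarrow> a \<in> shifted_cylinder (length w) w"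
  by (auto simp: list_eq_iff_nth_eq past_nth shifted_cylinder_def)

lemma measurable_shifted_cylinder:
  "shifted_cylinder j w \<in> sets (two_sided :: (int \<Rightarrow> 'i) measure)" for w :: "'i list"
proof -
  have "(\<lambda>x. x l) \<in> measurable (two_sided :: (int \<Rightarrow> 'i) measure) (count_space UNIV)" for l
    unfolding two_sided_def by (rule measurable_component_singleton) simp
  from measurable_sets[OF this, of "{w ! k}" for k]
  have "{x. x (int k + 1 - int j) = w ! k} \<in> sets (two_sided :: (int \<Rightarrow> 'i) measure)" for k
    by (simp add: two_sided_def space_PiM vimage_def)
  moreover have "UNIV \<in> sets (two_sided :: (int \<Rightarrow> 'i) measure)"
    using sets.top[of "two_sided :: (int \<Rightarrow> 'i) measure"] by (simp add: two_sided_def space_PiM)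
  ultimately have "(\<Inter>k\<in>{..<length w}. {x. x (int k + 1 - int j) = w ! k}) \<in> sets (two_sided :: (int \<Rightarrow> 'i) measure)"
    by (intro sets.countable_INT'') auto
  also have "(\<Inter>k\<in>{..<length w}. {x. x (int k + 1 - int j) = w ! k}) = shifted_cylinder j w"
    by (auto simp: shifted_cylinder_def)
  finally show ?thesis .
qed

lemma emeasure_shifted_cylinder:
  fixes \<nu> :: "(int \<Rightarrow> 'i) measure"
  assumes "is_natural_extension \<mu> \<nu>"
  shows "emeasure \<nu> (shifted_cylinder j w) = emeasure \<mu> (cylinder w)"
proof (induction j)
  case 0
  have "shifted_cylinder 0 w = positive_cylinder w"
    by (simp add: shifted_cylinder_def positive_cylinder_def)
  then show ?case using assms by (simp add: is_natural_extension_def)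
next
  case (Suc j)
  let ?S = "\<lambda>a k. a (k + 1) :: 'i"
  have sets: "sets \<nu> = sets two_sided" and inv: "distr \<nu> \<nu> ?S = \<nu>"
    using assms by (auto simp: is_natural_extension_def)
  have space: "space \<nu> = UNIV"
    using sets_eq_imp_space_eq[OF sets] by (simp add: two_sided_def space_PiM)
  have "?S \<in> measurable two_sided (two_sided :: (int \<Rightarrow> 'i) measure)"
    unfolding two_sided_def by (rule measurable_PiM_single') (auto simp: space_PiM)
  then have S: "?S \<in> measurable \<nu> \<nu>"
    using measurable_cong_sets[OF sets sets] by simp
  have "emeasure \<nu> (shifted_cylinder (Suc j) w) = emeasure \<nu> (?S -` shifted_cylinder (Suc j) w \<inter> space \<nu>)"
    using emeasure_distr[OF S, of "shifted_cylinder (Suc j) w"] measurable_shifted_cylinder[of "Suc j" w]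
    unfolding inv sets by simp
  also have "?S -` shifted_cylinder (Suc j) w \<inter> space \<nu> = shifted_cylinder j w"
    by (auto simp: space shifted_cylinder_def algebra_simps)
  finally show ?case using Suc by simp
qed

lemma finite_words: "finite {w :: 'i::finite list. length w = n}" "finite {w :: 'i list. length w \<le> n}"
  using finite_lists_length_eq[of "UNIV :: 'i set" n] finite_lists_length_le[of "UNIV :: 'i set" n]
  by auto

section \<open>Gibbs bounds and economical covers\<close>

locale kaenmaki_ifs = positive_ifs A d E
  for A :: "'i::finite \<Rightarrow> real^2^2" and d E +
  fixes \<mu> :: "(nat \<Rightarrow> 'i) measure" and \<nu> :: "(int \<Rightarrow> 'i) measure"
  assumes kaenmaki: "is_kaenmaki_measure A \<mu>"
    and natural_extension: "is_natural_extension \<mu> \<nu>"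
begin

abbreviation s :: real where "s \<equiv> affinity_dim A"
abbreviation \<phi> :: "'i list \<Rightarrow> real" where "\<phi> w \<equiv> sv_fun s (W w)"

lemma gibbs:
  obtains C where "C > 0" "\<And>w. \<phi> w \<le> C * measure \<mu> (cylinder w)"
    "\<And>w. measure \<mu> (cylinder w) \<le> C * \<phi> w"
proof -
  obtain C where C: "C > 0" "\<And>w. inverse C * \<phi> w \<le> measure \<mu> (cylinder w)"
    "\<And>w. measure \<mu> (cylinder w) \<le> C * \<phi> w"
    using kaenmaki by (auto simp: is_kaenmaki_measure_def)
  have "\<phi> w \<le> C * measure \<mu> (cylinder w)" for w
    using C(1) C(2)[of w] by (simp add: field_simps)
  then show ?thesis using that C by blast
qed

lemma sum_measure_le_1:
  assumes "finite Z" "\<And>w w'. w \<in> Z \<Longrightarrow> w' \<in> Z \<Longrightarrow> prefix w w' \<Longrightarrow> w = w'"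
  shows "(\<Sum>w\<in>Z. measure \<mu> (cylinder w)) \<le> 1"
proof -
  interpret prob_space \<mu> using kaenmaki by (simp add: is_kaenmaki_measure_def)
  have sets: "sets \<mu> = sets one_sided" using kaenmaki by (simp add: is_kaenmaki_measure_def)
  have "disjoint_family_on cylinder Z"
    unfolding disjoint_family_on_def using assms(2) cylinder_disjoint by metis
  then have "(\<Sum>w\<in>Z. measure \<mu> (cylinder w)) = measure \<mu> (\<Union>w\<in>Z. cylinder w)"
    using assms(1) by (intro finite_measure_finite_Union[symmetric]) (auto simp: sets measurable_cylinder)
  then show ?thesis by simp
qed

text \<open>A Kraft inequality: cylinders of prefix-free words are disjoint, and the Gibbs property
  compares \<open>\<phi>\<close> with their mass.\<close>

lemma sum_sv_fun_bounded:
  obtains C where "C > 0" "\<And>Z. finite Z \<Longrightarrow> (\<And>w w'. w \<in> Z \<Longrightarrow> w' \<in> Z \<Longrightarrow> prefix w w' \<Longrightarrow> w = w') \<Longrightarrow>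
    (\<Sum>w\<in>Z. \<phi> w) \<le> C"
proof -
  obtain C where C: "C > 0" "\<And>w. \<phi> w \<le> C * measure \<mu> (cylinder w)"
    by (rule gibbs) blast
  have "(\<Sum>w\<in>Z. \<phi> w) \<le> C"
    if Z: "finite Z" "\<And>w w'. w \<in> Z \<Longrightarrow> w' \<in> Z \<Longrightarrow> prefix w w' \<Longrightarrow> w = w'" for Z
  proof -
    have "(\<Sum>w\<in>Z. \<phi> w) \<le> C * (\<Sum>w\<in>Z. measure \<mu> (cylinder w))"
      unfolding sum_distrib_left by (intro sum_mono C)
    also have "\<dots> \<le> C * 1"
      using C(1) by (intro mult_left_mono sum_measure_le_1 Z) auto
    finally show ?thesis by simp
  qed
  then show ?thesis using that C(1) by blast
qed

text \<open>Puts \<open>\<phi>\<close> into the regime where both singular values enter. Were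
  \<open>s < 1\<close>, the sums of \<open>s1\<close> over words of length \<open>n\<close> would
  decay geometrically, and covering by the pieces would leave a projection of length zero.\<close>

lemma affinity_dim_ge_1:
  assumes p: "norm p = 1" and pos: "emeasure lborel ((\<lambda>x. x \<bullet> perp p) ` E) > 0"
  shows "s \<ge> 1"
proof (rule ccontr)
  assume "\<not> s \<ge> 1"
  then have s: "s < 1" by simp
  obtain C where C: "C > 0" "\<And>Z. finite Z \<Longrightarrow>
    (\<And>w w'. w \<in> Z \<Longrightarrow> w' \<in> Z \<Longrightarrow> prefix w w' \<Longrightarrow> w = w') \<Longrightarrow> (\<Sum>w\<in>Z. \<phi> w) \<le> C"
    by (rule sum_sv_fun_bounded) blast
  define R where "R = diameter E"
  have R: "norm (x - y) \<le> R" if "x \<in> E" "y \<in> E" for x y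
    using diameter_bounded_bound[OF compact_imp_bounded[OF compact_E] that] by (simp add: R_def dist_norm)
  have R0: "R \<ge> 0" unfolding R_def by (intro diameter_ge_0 compact_imp_bounded compact_E)
  \<comment> \<open>Splitting \<open>s1\<close> into \<open>s1 powr s * s1 powr (1 - s)\<close>
    leaves \<open>\<phi>\<close> in the first factor and gains \<open>\<kappa>\<close> per letter in
    the second.\<close>
  define \<kappa> where "\<kappa> = contr powr (1 - s)"
  have \<kappa>: "0 \<le> \<kappa>" "\<kappa> < 1"
    using contr_pos contr_less_1 s powr_less_mono2[of "1 - s" contr 1] by (auto simp: \<kappa>_def)
  have bound: "emeasure lborel ((\<lambda>x. x \<bullet> perp p) ` E) \<le> ennreal (2 * R * C * \<kappa> ^ n)" for n
  proof -
    let ?Z = "{w :: 'i list. length w = n}"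
    have "emeasure lborel ((\<lambda>x. x \<bullet> perp p) ` E) \<le> ennreal (\<Sum>w\<in>?Z. 2 * (s1 w * R))"
    proof (rule emeasure_image_le_sum[where f = "\<lambda>x. x \<bullet> perp p" and E = E and I = ?Z and
          X = "\<lambda>w. T w ` E" and r = "\<lambda>w. s1 w * R"])
      fix w x' y' assume "x' \<in> T w ` E" "y' \<in> T w ` E"
      then obtain x y where xy: "x \<in> E" "y \<in> E" "x' = T w x" "y' = T w y" by auto
      have "\<bar>x' \<bullet> perp p - y' \<bullet> perp p\<bar> \<le> norm (x' - y') * norm (perp p)"
        unfolding inner_diff_left[symmetric] by (rule Cauchy_Schwarz_ineq2)
      also have "\<dots> = norm (W w *v (x - y))" by (simp add: p xy T_diff)
      also have "\<dots> \<le> s1 w * norm (x - y)" by (rule sing_val1_norm_le)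
      also have "\<dots> \<le> s1 w * R" using R xy s1_pos[of w] by (intro mult_left_mono) auto
      finally show "\<bar>x' \<bullet> perp p - y' \<bullet> perp p\<bar> \<le> s1 w * R" .
    next
      show "E \<subseteq> (\<Union>w\<in>?Z. T w ` E)" by (rule E_subset_words)
      show "0 \<le> s1 w * R" for w using R0 s1_pos[of w] by simp
    qed (rule finite_words)
    also have "\<dots> \<le> ennreal (2 * R * C * \<kappa> ^ n)"
    proof (rule ennreal_leI)
      have "s1 w \<le> \<phi> w * \<kappa> ^ n" if "w \<in> ?Z" for w
      proof -
        have "s1 w = s1 w powr s * s1 w powr (1 - s)"
          using s1_pos[of w] by (simp add: powr_add[symmetric])
        also have "\<dots> \<le> s1 w powr s * (contr ^ n) powr (1 - s)"
          using s1_le_power[of w] s1_pos[of w] that s by (intro mult_left_mono powr_mono2) auto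
        also have "(contr ^ n) powr (1 - s) = \<kappa> ^ n"
          using contr_pos by (simp add: \<kappa>_def powr_realpow[symmetric] powr_powr mult.commute)
        finally show ?thesis using s by (simp add: sv_fun_def)
      qed
      then have "(\<Sum>w\<in>?Z. 2 * (s1 w * R)) \<le> (\<Sum>w\<in>?Z. 2 * (\<phi> w * \<kappa> ^ n * R))"
        using R0 by (intro sum_mono mult_left_mono mult_right_mono) auto
      also have "\<dots> = 2 * R * (\<Sum>w\<in>?Z. \<phi> w) * \<kappa> ^ n"
        by (simp add: sum_distrib_left sum_distrib_right ac_simps)
      also have "\<dots> \<le> 2 * R * C * \<kappa> ^ n"
        using R0 \<kappa> by (intro mult_right_mono mult_left_mono C finite_words) (auto simp: prefix_def)
      finally show "(\<Sum>w\<in>?Z. 2 * (s1 w * R)) \<le> 2 * R * C * \<kappa> ^ n" .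
    qed
    finally show ?thesis .
  qed
  have "(\<lambda>n. 2 * R * C * \<kappa> ^ n) \<longlonglongrightarrow> 2 * R * C * 0"
    using \<kappa> by (intro tendsto_mult_left LIMSEQ_power_zero) auto
  then have "(\<lambda>n. ennreal (2 * R * C * \<kappa> ^ n)) \<longlonglongrightarrow> ennreal 0"
    by (intro tendsto_ennrealI) simp
  then have "emeasure lborel ((\<lambda>x. x \<bullet> perp p) ` E) \<le> ennreal 0"
    by (rule LIMSEQ_le_const) (use bound in auto)
  then show False using pos by simp
qed

lemma sv_fun_eq: "s \<ge> 1 \<Longrightarrow> \<phi> w = s1 w * s2 w powr (s - 1)"
  using s1_pos[of w] s2_pos[of w] by (auto simp: sv_fun_def)

text \<open>In \<open>\<phi> w = s1 w * s2 w powr (s - 1)\<close> the second factor is replaced by a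
  power of the comparable \<open>\<delta>\<close>; the exponent \<open>1 - s\<close> is nonpositive,
  so inequalities reverse.\<close>

lemma s1_bounds:
  assumes s: "s \<ge> 1" and \<delta>: "\<delta> > 0" "min_sv * \<delta> \<le> s2 w" "s2 w \<le> \<delta>"
  shows "\<phi> w * \<delta> powr (1 - s) \<le> s1 w" "s1 w \<le> \<phi> w * (min_sv powr (1 - s) * \<delta> powr (1 - s))"
proof -
  have \<phi>: "\<phi> w * s2 w powr (1 - s) = s1 w"
    using s2_pos[of w] by (simp add: sv_fun_eq[OF s] mult.assoc powr_add[symmetric])
  have nonneg: "\<phi> w \<ge> 0" using s1_pos[of w] by (simp add: sv_fun_eq[OF s])
  have "\<delta> powr (1 - s) \<le> s2 w powr (1 - s)"
    using s \<delta> s2_pos[of w] by (intro powr_mono2') auto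
  then show "\<phi> w * \<delta> powr (1 - s) \<le> s1 w"
    using mult_left_mono[OF _ nonneg] \<phi> by metis
  have "s2 w powr (1 - s) \<le> (min_sv * \<delta>) powr (1 - s)"
    using s \<delta> min_sv_pos by (intro powr_mono2') auto
  also have "\<dots> = min_sv powr (1 - s) * \<delta> powr (1 - s)"
    using min_sv_pos \<delta> by (simp add: powr_mult)
  finally show "s1 w \<le> \<phi> w * (min_sv powr (1 - s) * \<delta> powr (1 - s))"
    using mult_left_mono[OF _ nonneg] \<phi> by metis
qed

text \<open>\<open>E\<close> is divided along words cut at scale \<open>\<delta>\<close>, each piece
  needs a multiple of \<open>s1 w / \<delta>\<close> sets, and this is comparable to
  \<open>\<phi> w * \<delta> powr (- s)\<close>. Prefix-freeness bounds the sum of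
  \<open>\<phi>\<close>.\<close>

lemma exists_cover:
  assumes s: "s \<ge> 1"
  obtains C where "C > 0" "\<And>\<delta>. 0 < \<delta> \<Longrightarrow> \<delta> < 1 \<Longrightarrow> \<exists>F. finite F \<and> card F \<le> C * \<delta> powr (- s) \<and>
    E \<subseteq> \<Union>F \<and> (\<forall>U\<in>F. bounded U \<and> diameter U \<le> \<delta>)"
proof -
  obtain C1 where C1: "C1 > 0" "\<And>w \<delta>. \<delta> > 0 \<Longrightarrow> min_sv * \<delta> \<le> s2 w \<Longrightarrow> s2 w \<le> \<delta> \<Longrightarrow>
    \<exists>F. finite F \<and> card F \<le> C1 * s1 w / \<delta> \<and> T w ` E \<subseteq> \<Union>F \<and> (\<forall>U\<in>F. bounded U \<and> diameter U \<le> \<delta>)"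
    by (rule cover_word_image) blast
  obtain C2 where C2: "C2 > 0" "\<And>Z. finite Z \<Longrightarrow>
    (\<And>w w'. w \<in> Z \<Longrightarrow> w' \<in> Z \<Longrightarrow> prefix w w' \<Longrightarrow> w = w') \<Longrightarrow> (\<Sum>w\<in>Z. \<phi> w) \<le> C2"
    by (rule sum_sv_fun_bounded) blast
  define C where "C = C1 * min_sv powr (1 - s) * C2"
  have "\<exists>F. finite F \<and> card F \<le> C * \<delta> powr (- s) \<and>
    E \<subseteq> \<Union>F \<and> (\<forall>U\<in>F. bounded U \<and> diameter U \<le> \<delta>)" if \<delta>: "0 < \<delta>" "\<delta> < 1" for \<delta>
  proof -
    \<comment> \<open>Words cut off on the right: as \<open>s2\<close> decreases under extension, a
      proper extension of a word in \<open>Z\<close> has its \<open>butlast\<close> already below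
      \<open>\<delta>\<close>, which gives prefix-freeness.\<close>
    define Z where "Z = {w. w \<noteq> [] \<and> s2 w \<le> \<delta> \<and> \<delta> < s2 (butlast w)}"
    obtain N where N: "contr ^ N < \<delta>"
      using real_arch_pow_inv[OF \<delta>(1) contr_less_1] by blast
    have "Z \<subseteq> {w. length w \<le> N}"
    proof
      fix w assume w: "w \<in> Z"
      then have "contr ^ N < contr ^ length (butlast w)"
        using N s2_le_power[of "butlast w"] by (simp add: Z_def del: length_butlast)
      then have "length (butlast w) < N"
        using contr_pos contr_less_1 by (simp add: power_strict_decreasing_iff)
      then show "w \<in> {w. length w \<le> N}" by auto
    qed
    then have fin: "finite Z" using finite_words(2) finite_subset by blast
    have Zge: "min_sv * \<delta> \<le> s2 w" if "w \<in> Z" for w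
    proof -
      have "min_sv * \<delta> \<le> min_sv * s2 (butlast w)"
        using that min_sv_pos by (simp add: Z_def)
      also have "\<dots> \<le> s2 w"
        using s2_snoc_ge[of "butlast w" "last w"] that by (simp add: Z_def)
      finally show ?thesis .
    qed
    have prefix_free: "w = w'" if ww: "w \<in> Z" "w' \<in> Z" "prefix w w'" for w w'
    proof (rule ccontr)
      assume "w \<noteq> w'"
      then obtain v where v: "v \<noteq> []" "w' = w @ v" using ww(3) by (auto simp: prefix_def)
      then have "butlast w' = w @ butlast v" by (simp add: butlast_append)
      then have "s2 (butlast w') \<le> s2 w" by (simp add: s2_prefix_le)
      then show False using ww by (simp add: Z_def)
    qed
    have E_sub: "E \<subseteq> (\<Union>w\<in>Z. T w ` E)"
    proof
      fix x assume "x \<in> E"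
      then obtain w y where w: "length w = N" "y \<in> E" "x = T w y"
        using E_subset_words[of N] by auto
      define m where "m = (LEAST m. s2 (take m w) \<le> \<delta>)"
      have "s2 (take N w) \<le> \<delta>" using s2_le_power[of w] N w(1) by simp
      then have m: "s2 (take m w) \<le> \<delta>" "m \<le> N"
        unfolding m_def by (auto intro: LeastI Least_le)
      \<comment> \<open>The empty word has \<open>s2\<close> equal to \<open>1\<close>, which
        exceeds \<open>\<delta>\<close>.\<close>
      have "m \<noteq> 0" using m(1) \<delta> by (intro notI) (simp add: sing_val_mat_1)
      then have "\<not> s2 (take (m - 1) w) \<le> \<delta>"
        unfolding m_def by (intro not_less_Least) simp
      then have "take m w \<in> Z"
        using m w(1) \<open>m \<noteq> 0\<close> by (auto simp: Z_def butlast_take)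
      moreover have "x = T (take m w) (T (drop m w) y)"
        by (simp add: w(3) T_append[symmetric])
      ultimately show "x \<in> (\<Union>w\<in>Z. T w ` E)" using T_in_E[OF w(2)] by blast
    qed
    have "\<forall>w\<in>Z. \<exists>F. finite F \<and> card F \<le> C1 * s1 w / \<delta> \<and> T w ` E \<subseteq> \<Union>F \<and>
        (\<forall>U\<in>F. bounded U \<and> diameter U \<le> \<delta>)"
      using C1(2)[OF \<delta>(1)] Zge by (simp add: Z_def)
    then obtain F where F: "\<And>w. w \<in> Z \<Longrightarrow> finite (F w)" "\<And>w. w \<in> Z \<Longrightarrow> card (F w) \<le> C1 * s1 w / \<delta>"
      "\<And>w. w \<in> Z \<Longrightarrow> T w ` E \<subseteq> \<Union>(F w)" "\<And>w U. w \<in> Z \<Longrightarrow> U \<in> F w \<Longrightarrow> bounded U \<and> diameter U \<le> \<delta>"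
      by metis
    have "real (card (\<Union>w\<in>Z. F w)) \<le> (\<Sum>w\<in>Z. real (card (F w)))"
      using card_UN_le[OF fin, of F] by (simp flip: of_nat_sum)
    also have "\<dots> \<le> (\<Sum>w\<in>Z. C1 * (\<phi> w * (min_sv powr (1 - s) * \<delta> powr (1 - s))) / \<delta>)"
    proof (rule sum_mono)
      fix w assume w: "w \<in> Z"
      have "card (F w) \<le> C1 * s1 w / \<delta>" by (rule F(2)[OF w])
      also have "\<dots> \<le> C1 * (\<phi> w * (min_sv powr (1 - s) * \<delta> powr (1 - s))) / \<delta>"
        using s1_bounds(2)[OF s \<delta>(1) Zge[OF w]] w C1(1) \<delta>(1)
        by (intro divide_right_mono mult_left_mono) (auto simp: Z_def)
      finally show "card (F w) \<le> C1 * (\<phi> w * (min_sv powr (1 - s) * \<delta> powr (1 - s))) / \<delta>" .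
    qed
    also have "\<dots> = C1 * min_sv powr (1 - s) * (\<Sum>w\<in>Z. \<phi> w) * (\<delta> powr (1 - s) / \<delta>)"
      by (simp add: sum_distrib_left sum_distrib_right sum_divide_distrib ac_simps)
    also have "\<dots> \<le> C1 * min_sv powr (1 - s) * C2 * (\<delta> powr (1 - s) / \<delta>)"
      using C1(1) \<delta> C2(2)[OF fin prefix_free] by (intro mult_right_mono mult_left_mono) auto
    also have "\<delta> powr (1 - s) / \<delta> = \<delta> powr (- s)"
      using \<delta>(1) by (simp add: powr_diff powr_minus field_simps)
    finally have "card (\<Union>w\<in>Z. F w) \<le> C * \<delta> powr (- s)" by (simp add: C_def)
    moreover have "E \<subseteq> \<Union>(\<Union>w\<in>Z. F w)"
    proof
      fix x assume "x \<in> E"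
      then obtain w where w: "w \<in> Z" "x \<in> T w ` E" using E_sub by auto
      then have "x \<in> \<Union>(F w)" by (intro subsetD[OF F(3)])
      with w(1) show "x \<in> \<Union>(\<Union>w\<in>Z. F w)" by auto
    qed
    moreover have "finite (\<Union>w\<in>Z. F w)" using fin F(1) by simp
    moreover have "\<forall>U\<in>(\<Union>w\<in>Z. F w). bounded U \<and> diameter U \<le> \<delta>" using F(4) by blast
    ultimately show ?thesis by blast
  qed
  moreover have "C > 0" using C1(1) C2(1) min_sv_pos by (simp add: C_def)
  ultimately show ?thesis using that by blast
qed

end

section \<open>The lower bound\<close>

context kaenmaki_ifs
begin

text \<open>The direction \<open>p\<close> stands for a Furstenberg direction of some past ending in
  \<open>w\<close>. Quantifying over \<open>p\<close> makes membership depend on the word alone, so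
  conditions on pasts become unions of cylinders.\<close>

definition large_words :: "real \<Rightarrow> 'i list set" where
  "large_words \<eta> = {w. \<exists>p. norm p = 1 \<and> W w *v p \<in> second_quadrant \<and>
     ennreal \<eta> \<le> emeasure lborel ((\<lambda>x. x \<bullet> perp p) ` E)}"

text \<open>
  Words are extended to the left until the stopping rule applies, because shift invariance controls
  the words that end at a fixed coordinate, and these are the ones that determine the Furstenberg
  direction. The price is that words of this set can be prefixes of each other.
\<close>

definition stopping :: "real \<Rightarrow> 'i list set" where
  "stopping \<delta> = {w. w \<noteq> [] \<and> s2 w \<le> \<delta> \<and> \<delta> < s2 (tl w)}"

lemma finite_stopping:
  assumes "\<delta> > 0"
  shows "finite (stopping \<delta>)"
proof -
  obtain N where N: "contr ^ N < \<delta>"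
    using real_arch_pow_inv[OF assms contr_less_1] by blast
  have "stopping \<delta> \<subseteq> {w. length w \<le> N}"
  proof
    fix w assume w: "w \<in> stopping \<delta>"
    then have "contr ^ N < contr ^ length (tl w)"
      using N s2_le_power[of "tl w"] by (simp add: stopping_def del: length_tl)
    then have "length (tl w) < N"
      using contr_pos contr_less_1 by (simp add: power_strict_decreasing_iff)
    then show "w \<in> {w. length w \<le> N}" by auto
  qed
  then show ?thesis using finite_words(2) finite_subset by blast
qed

lemma stopping_bounds:
  assumes "w \<in> stopping \<delta>"
  shows "min_sv * \<delta> \<le> s2 w" "s2 w \<le> \<delta>"
proof -
  have "min_sv * \<delta> \<le> min_sv * s2 (tl w)"
    using assms min_sv_pos by (simp add: stopping_def)
  also have "\<dots> \<le> s2 w"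
    using s2_Cons_ge[of "tl w" "hd w"] assms by (simp add: stopping_def del: word_matrix_simps)
  finally show "min_sv * \<delta> \<le> s2 w" .
  show "s2 w \<le> \<delta>" using assms by (simp add: stopping_def)
qed

lemma past_stops:
  assumes "0 < \<delta>" "\<delta> < 1"
  shows "\<exists>n. past a n \<in> stopping \<delta>"
proof -
  obtain N where N: "contr ^ N < \<delta>"
    using real_arch_pow_inv[OF assms(1) contr_less_1] by blast
  define n where "n = (LEAST n. s2 (past a n) \<le> \<delta>)"
  have "s2 (past a N) \<le> \<delta>" using s2_le_power[of "past a N"] N by simp
  then have n: "s2 (past a n) \<le> \<delta>" unfolding n_def by (rule LeastI)
  then have "n \<noteq> 0" using assms by (intro notI) (simp add: sing_val_mat_1)
  then obtain m where m: "n = Suc m" by (cases n) auto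
  then have "\<not> s2 (past a m) \<le> \<delta>"
    unfolding n_def by (intro not_less_Least) simp
  then have "past a n \<in> stopping \<delta>"
    using n by (simp add: m stopping_def)
  then show ?thesis ..
qed

text \<open>Sequences all of whose pasts are \<open>\<eta>\<close>-large have positive mass for some
  \<open>\<eta>\<close>. At any scale each such sequence has a stopping past, so the cylinders of
  the large stopping words carry at least this mass, uniformly in \<open>\<delta>\<close>.\<close>

lemma sum_large_words_ge:
  assumes S: "emeasure (furstenberg_measure A \<nu>) S > 0"
    and pos: "\<And>\<theta>. \<theta> \<in> S \<Longrightarrow> emeasure lborel ((\<lambda>x. x \<bullet> perp (rep_rp1 \<theta>)) ` E) > 0"
  obtains \<eta> P where "\<eta> > 0" "P > 0"
    "\<And>\<delta>. 0 < \<delta> \<Longrightarrow> \<delta> < 1 \<Longrightarrow> P \<le> (\<Sum>w\<in>stopping \<delta> \<inter> large_words \<eta>. measure \<mu> (cylinder w))"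
proof -
  interpret \<mu>: prob_space \<mu> using kaenmaki by (simp add: is_kaenmaki_measure_def)
  have sets: "sets \<nu> = sets two_sided"
    using natural_extension by (simp add: is_natural_extension_def)
  let ?cyl = "\<lambda>w. shifted_cylinder (length w) w :: (int \<Rightarrow> 'i) set"
  have cyl_sets: "?cyl w \<in> sets \<nu>" for w by (simp add: sets measurable_shifted_cylinder)
  have cyl_measure: "emeasure \<nu> (?cyl w) = ennreal (measure \<mu> (cylinder w))" for w
    using emeasure_shifted_cylinder[OF natural_extension] by (simp add: \<mu>.emeasure_eq_measure)
  have past_cyl: "a \<in> ?cyl (past a n)" for a n
    using past_eq_iff[of a "past a n"] by simp
  define B where "B = furstenberg_map A -` S \<inter> space \<nu>"
  \<comment> \<open>Sequences whose pasts of every length are large with threshold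
    \<open>1 / (k + 1)\<close>, written as a countable intersection of finite unions of cylinders so
    that measurability is immediate.\<close>
  define H where "H k = (\<Inter>n. \<Union>w\<in>{w. length w = n} \<inter> large_words (inverse (real (Suc k))). ?cyl w)" for k
  \<comment> \<open>The measure underlying \<open>distr\<close> is either given by the preimage
    formula or zero, so a positive value forces the former; measurability of
    \<open>furstenberg_map\<close> does not enter.\<close>
  have B: "emeasure \<nu> B > 0"
    using S unfolding furstenberg_measure_def distr_def emeasure_measure_of_conv B_def
    by (auto split: if_splits)
  have H_sets: "H k \<in> sets \<nu>" for k
    unfolding H_def
    by (intro sets.countable_INT sets.finite_UN) (auto simp: cyl_sets finite_words)
  have "B \<subseteq> (\<Union>k. H k)"
  proof
    fix a assume "a \<in> B"
    let ?p = "rep_rp1 (furstenberg_map A a)"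
    obtain r where r: "r > 0" "ennreal r \<le> emeasure lborel ((\<lambda>x. x \<bullet> perp ?p) ` E)"
      using pos[of "furstenberg_map A a"] \<open>a \<in> B\<close> ennreal_pos_obtain by (auto simp: B_def)
    obtain k where "inverse (real (Suc k)) < r" using reals_Archimedean[OF r(1)] by blast
    then have "ennreal (inverse (real (Suc k))) \<le> emeasure lborel ((\<lambda>x. x \<bullet> perp ?p) ` E)"
      using r(2) by (meson ennreal_leI less_imp_le order_trans)
    then have "past a n \<in> large_words (inverse (real (Suc k)))" for n
      unfolding large_words_def using furstenberg_map_past[of a n] norm_rep_rp1 by blast
    then have "a \<in> H k"
      unfolding H_def using past_cyl[of a] by (intro INT_I UN_I[of "past a _"]) auto
    then show "a \<in> (\<Union>k. H k)" by blast
  qed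
  then have "emeasure \<nu> B \<le> emeasure \<nu> (\<Union>k. H k)"
    using H_sets by (intro emeasure_mono) auto
  then have "emeasure \<nu> (\<Union>k. H k) \<noteq> 0" using B by auto
  then obtain k where k: "emeasure \<nu> (H k) > 0"
    using emeasure_UN_eq_0[of \<nu> H] H_sets by (auto simp: zero_less_iff_neq_zero)
  define \<eta> where "\<eta> = inverse (real (Suc k))"
  obtain P where P: "P > 0" "ennreal P \<le> emeasure \<nu> (H k)"
    using ennreal_pos_obtain[OF k] .
  have "P \<le> (\<Sum>w\<in>stopping \<delta> \<inter> large_words \<eta>. measure \<mu> (cylinder w))"
    if \<delta>: "0 < \<delta>" "\<delta> < 1" for \<delta>
  proof -
    let ?Z = "stopping \<delta> \<inter> large_words \<eta>"
    have fin: "finite ?Z" using finite_stopping[OF \<delta>(1)] by simp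
    have "H k \<subseteq> (\<Union>w\<in>?Z. ?cyl w)"
    proof
      fix a assume a: "a \<in> H k"
      obtain n where n: "past a n \<in> stopping \<delta>" using past_stops[OF \<delta>] by blast
      obtain w where w: "length w = n" "w \<in> large_words \<eta>" "a \<in> ?cyl w"
        using a unfolding H_def \<eta>_def by blast
      then have "past a n = w" using past_eq_iff[of a w] by simp
      then show "a \<in> (\<Union>w\<in>?Z. ?cyl w)" using n w by (intro UN_I[of w]) auto
    qed
    then have "emeasure \<nu> (H k) \<le> emeasure \<nu> (\<Union>w\<in>?Z. ?cyl w)"
      using fin cyl_sets by (intro emeasure_mono sets.finite_UN) auto
    also have "\<dots> \<le> (\<Sum>w\<in>?Z. emeasure \<nu> (?cyl w))"
      using fin cyl_sets by (intro emeasure_subadditive_finite) auto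
    also have "\<dots> = ennreal (\<Sum>w\<in>?Z. measure \<mu> (cylinder w))"
      unfolding cyl_measure by (intro sum_ennreal) simp
    finally have "ennreal P \<le> ennreal (\<Sum>w\<in>?Z. measure \<mu> (cylinder w))"
      using P(2) by (rule order_trans[rotated])
    then show ?thesis by (subst (asm) ennreal_le_iff) (auto intro: sum_nonneg)
  qed
  moreover have "\<eta> > 0" by (simp add: \<eta>_def)
  ultimately show ?thesis using that P(1) by blast
qed

text \<open>Double counting of pairs of a large stopping word and a covering set that meets its
  piece. Each word meets many sets by \<open>card_meeting_ge\<close>, each set meets at most
  \<open>Suc L\<close> pieces, and the mass bound \<open>P\<close> together with the Gibbs property
  sums the contributions.\<close>

lemma covers_are_large:
  assumes s: "s \<ge> 1" and S: "emeasure (furstenberg_measure A \<nu>) S > 0"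
    and pos: "\<And>\<theta>. \<theta> \<in> S \<Longrightarrow> emeasure lborel ((\<lambda>x. x \<bullet> perp (rep_rp1 \<theta>)) ` E) > 0"
  obtains c \<rho> where "c > 0" "\<rho> > 0" "\<And>\<delta> F. 0 < \<delta> \<Longrightarrow> \<delta> < 1 \<Longrightarrow> finite F \<Longrightarrow> E \<subseteq> \<Union>F \<Longrightarrow>
    (\<And>U. U \<in> F \<Longrightarrow> bounded U \<and> diameter U \<le> \<rho> * \<delta>) \<Longrightarrow> c * \<delta> powr (- s) \<le> card F"
proof -
  obtain \<eta> P where P: "\<eta> > 0" "P > 0" "\<And>\<delta>. 0 < \<delta> \<Longrightarrow> \<delta> < 1 \<Longrightarrow>
      P \<le> (\<Sum>w\<in>stopping \<delta> \<inter> large_words \<eta>. measure \<mu> (cylinder w))"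
    by (rule sum_large_words_ge[OF S pos]) auto
  obtain \<rho> L where \<rho>: "\<rho> > 0" and multiplicity:
    "\<And>Z U \<delta>. finite Z \<Longrightarrow> \<delta> > 0 \<Longrightarrow> bounded U \<Longrightarrow> diameter U \<le> \<rho> * \<delta> \<Longrightarrow>
      (\<And>w. w \<in> Z \<Longrightarrow> min_sv * \<delta> \<le> s2 w \<and> s2 w \<le> \<delta> \<and> U \<inter> T w ` E \<noteq> {}) \<Longrightarrow> card Z \<le> Suc L"
    by (rule multiplicity_bound) blast
  obtain C where C: "C > 0"
    "\<And>w p. norm p = 1 \<Longrightarrow> W w *v p \<in> second_quadrant \<Longrightarrow> norm (W w *v p) \<le> C * s2 w"
    by (rule norm_mult_le_of_second_quadrant) blast
  obtain G where G: "G > 0" "\<And>w. measure \<mu> (cylinder w) \<le> G * \<phi> w"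
    by (rule gibbs) blast
  define c where "c = \<eta> * P / (G * (2 * \<rho> * C * real (Suc L)))"
  have "c * \<delta> powr (- s) \<le> card F"
    if \<delta>: "0 < \<delta>" "\<delta> < 1" and F: "finite F" "E \<subseteq> \<Union>F"
      "\<And>U. U \<in> F \<Longrightarrow> bounded U \<and> diameter U \<le> \<rho> * \<delta>" for \<delta> F
  proof -
    let ?Z = "stopping \<delta> \<inter> large_words \<eta>"
    have fin: "finite ?Z" using finite_stopping[OF \<delta>(1)] by simp
    have "\<eta> * \<delta> powr (1 - s) * P \<le> \<eta> * \<delta> powr (1 - s) * (\<Sum>w\<in>?Z. G * \<phi> w)"
      using P(1) order_trans[OF P(3)[OF \<delta>] sum_mono[OF G(2)]] by (intro mult_left_mono) auto
    also have "\<dots> = G * (\<Sum>w\<in>?Z. \<eta> * (\<phi> w * \<delta> powr (1 - s)))"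
      by (simp add: sum_distrib_left ac_simps)
    also have "\<dots> \<le> G * (\<Sum>w\<in>?Z. \<eta> * s1 w)"
      using G(1) P(1) s1_bounds(1)[OF s \<delta>(1)] stopping_bounds
      by (intro mult_left_mono sum_mono) auto
    also have "(\<Sum>w\<in>?Z. \<eta> * s1 w) \<le> (\<Sum>w\<in>?Z. 2 * (\<rho> * \<delta>) * C * card {U \<in> F. U \<inter> T w ` E \<noteq> {}})"
    proof (rule sum_mono)
      fix w assume "w \<in> ?Z"
      then obtain p where p: "norm p = 1" "W w *v p \<in> second_quadrant"
        "ennreal \<eta> \<le> emeasure lborel ((\<lambda>x. x \<bullet> perp p) ` E)"
        by (auto simp: large_words_def)
      show "\<eta> * s1 w \<le> 2 * (\<rho> * \<delta>) * C * card {U \<in> F. U \<inter> T w ` E \<noteq> {}}"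
        using \<rho> \<delta>(1) by (intro card_meeting_ge[OF C(2) p F]) auto
    qed
    also have "\<dots> = 2 * (\<rho> * \<delta>) * C * real (\<Sum>w\<in>?Z. card {U \<in> F. U \<inter> T w ` E \<noteq> {}})"
      by (simp add: sum_distrib_left)
    \<comment> \<open>The pairs are now counted by covering sets instead of words.\<close>
    also have "(\<Sum>w\<in>?Z. card {U \<in> F. U \<inter> T w ` E \<noteq> {}}) = (\<Sum>U\<in>F. card {w \<in> ?Z. U \<inter> T w ` E \<noteq> {}})"
      unfolding card_eq_sum sum.inter_filter[OF fin] sum.inter_filter[OF F(1)] by (rule sum.swap)
    also have "\<dots> \<le> (\<Sum>U\<in>F. Suc L)"
    proof (rule sum_mono)
      fix U assume "U \<in> F"
      then show "card {w \<in> ?Z. U \<inter> T w ` E \<noteq> {}} \<le> Suc L"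
        using fin F(3)[of U] stopping_bounds[of _ \<delta>]
        by (intro multiplicity[of _ \<delta> U]) (use \<delta>(1) finite_stopping in auto)
    qed
    finally have "\<eta> * \<delta> powr (1 - s) * P \<le> G * (2 * (\<rho> * \<delta>) * C * real (card F * Suc L))"
      using G(1) \<rho> \<delta>(1) C(1) by simp
    moreover have "\<delta> powr (1 - s) = \<delta> * \<delta> powr (- s)"
      using \<delta>(1) by (simp add: powr_diff powr_minus field_simps)
    ultimately have "\<delta> * (\<eta> * P * \<delta> powr (- s)) \<le> \<delta> * (G * (2 * \<rho> * C * real (Suc L)) * card F)"
      by (simp add: algebra_simps)
    then have "\<eta> * P * \<delta> powr (- s) \<le> G * (2 * \<rho> * C * real (Suc L)) * card F"
      using \<delta>(1) by simp
    moreover have "G * (2 * \<rho> * C * real (Suc L)) > 0"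
      using G(1) \<rho> C(1) by simp
    ultimately show ?thesis
      unfolding c_def times_divide_eq_left by (subst pos_divide_le_eq) (simp_all only: ac_simps)
  qed
  moreover have "c > 0" using P(1,2) G(1) \<rho> C(1) by (simp add: c_def)
  ultimately show ?thesis using that \<rho> by blast
qed

lemma box_dim_eq_affinity_dim:
  assumes S: "emeasure (furstenberg_measure A \<nu>) S > 0"
    and pos: "\<And>\<theta>. \<theta> \<in> S \<Longrightarrow> emeasure lborel ((\<lambda>x. x \<bullet> perp (rep_rp1 \<theta>)) ` E) > 0"
  shows "has_box_dim E s"
proof -
  have "S \<noteq> {}" using S by auto
  then have s: "s \<ge> 1" using affinity_dim_ge_1[OF norm_rep_rp1] pos by blast
  obtain C where C: "C > 0" "\<And>\<delta>. 0 < \<delta> \<Longrightarrow> \<delta> < 1 \<Longrightarrow> \<exists>F. finite F \<and> card F \<le> C * \<delta> powr (- s) \<and>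
    E \<subseteq> \<Union>F \<and> (\<forall>U\<in>F. bounded U \<and> diameter U \<le> \<delta>)"
    by (rule exists_cover[OF s]) blast
  obtain c \<rho> where c: "c > 0" "\<rho> > 0" "\<And>\<delta> F. 0 < \<delta> \<Longrightarrow> \<delta> < 1 \<Longrightarrow> finite F \<Longrightarrow> E \<subseteq> \<Union>F \<Longrightarrow>
    (\<And>U. U \<in> F \<Longrightarrow> bounded U \<and> diameter U \<le> \<rho> * \<delta>) \<Longrightarrow> c * \<delta> powr (- s) \<le> card F"
    by (rule covers_are_large[OF s S pos]) auto
  \<comment> \<open>Ensures both \<open>\<delta> < 1\<close> for the upper bound and
    \<open>\<delta> / \<rho> < 1\<close> for the lower one.\<close>
  define \<delta>0 where "\<delta>0 = min 1 \<rho>"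
  have "\<delta>0 > 0" using c(2) by (simp add: \<delta>0_def)
  then have small: "\<forall>\<^sub>F \<delta> in at_right 0. 0 < \<delta> \<and> \<delta> < \<delta>0"
    by (auto simp: eventually_at_right_field)
  show ?thesis
  proof (rule box_dim_of_power_bounds)
    show "\<forall>\<^sub>F \<delta> in at_right 0. real (covering_number E \<delta>) \<le> C * \<delta> powr (- s)"
      using small
    proof eventually_elim
      case (elim \<delta>)
      then obtain F where F: "finite F" "card F \<le> C * \<delta> powr (- s)" "E \<subseteq> \<Union>F"
        "\<forall>U\<in>F. bounded U \<and> diameter U \<le> \<delta>"
        using C(2)[of \<delta>] by (auto simp: \<delta>0_def)
      then show ?case using covering_number_le[OF F(1,3,4)] by linarith
    qed
    show "\<forall>\<^sub>F \<delta> in at_right 0. c * \<rho> powr s * \<delta> powr (- s) \<le> real (covering_number E \<delta>)"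
      using small
    proof eventually_elim
      case (elim \<delta>)
      then obtain F where F: "finite F" "E \<subseteq> \<Union>F" "\<forall>U\<in>F. bounded U \<and> diameter U \<le> \<delta>"
        using C(2)[of \<delta>] by (auto simp: \<delta>0_def)
      obtain G where G: "finite G" "card G = covering_number E \<delta>" "E \<subseteq> \<Union>G"
        "\<And>U. U \<in> G \<Longrightarrow> bounded U \<and> diameter U \<le> \<delta>"
        by (rule covering_number_attained[OF F]) blast
      \<comment> \<open>Sets of diameter \<open>\<delta>\<close> are admissible at scale
        \<open>\<delta> / \<rho>\<close>; the rescaling costs only the constant
        \<open>\<rho> powr s\<close>.\<close>
      have "c * (\<delta> / \<rho>) powr (- s) \<le> card G"
        using elim c(2) G by (intro c(3)) (auto simp: \<delta>0_def)
      moreover have "(\<delta> / \<rho>) powr (- s) = \<rho> powr s * \<delta> powr (- s)"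
        using elim c(2) by (simp add: powr_divide powr_minus field_simps)
      ultimately show ?case by (simp add: G(2) mult.assoc)
    qed
    show "c * \<rho> powr s > 0" using c by simp
    show "C > 0" by (rule C(1))
  qed
qed

end

theorem theorem2:
  fixes A :: "'i::finite \<Rightarrow> real^2^2" and d :: "'i \<Rightarrow> real^2"
    and E :: "(real^2) set"
    and \<mu> :: "(nat \<Rightarrow> 'i) measure" and \<nu> :: "(int \<Rightarrow> 'i) measure"
  assumes "\<And>i. invertible (A i)"
    and "\<And>i j k. A i $ j $ k > 0"
    and "\<And>i. onorm ((*v) (A i)) < 1"
    and "is_attractor (affine_map A d) E"
    and "strong_separation (affine_map A d) E"
    and "is_kaenmaki_measure A \<mu>"
    and "is_natural_extension \<mu> \<nu>"
    and "\<exists>S \<in> sets (furstenberg_measure A \<nu>). emeasure (furstenberg_measure A \<nu>) S > 0 \<and>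
           (\<forall>\<theta>\<in>S. emeasure (lebesgue_perp \<theta>) (projection_along \<theta> ` E) > 0)"
  shows "has_box_dim E (affinity_dim A)"
proof -
  interpret kaenmaki_ifs A d E \<mu> \<nu>
    using assms(1-7) by unfold_locales
  show ?thesis
    using assms(8) box_dim_eq_affinity_dim unfolding emeasure_projection[OF compact_E] by blast
qed

end
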